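(* Let $F_2$ be the free group of rank $2$, $\varphi\in\mathrm{Aut}(F_2)$, $G=F_2\rtimes_\varphi\mathbb{Z}$, and let $[\overline{\varphi}]\in\mathrm{GL}_2(\mathbb{Z})$ be the matrix of the automorphism of $F_2^{ab}$ induced by $\varphi$. Suppose $\det[\overline{\varphi}]=1$. Then $G$ is residually nilpotent if and only if $\mathrm{tr}[\overline{\varphi}]\notin\{1,3\}$.
   Context: $F_2^{ab}=F_2/[F_2,F_2]\cong\mathbb{Z}^2$. $F_2\rtimes_\varphi\mathbb{Z}=\langle x,y,t\mid t^{-1}xt=\varphi(x),\ t^{-1}yt=\varphi(y)\rangle$, where $F_2=\langle x,y\rangle$. A group $G$ is residually nilpotent if every non-identity element has non-trivial image in some nilpotent quotient of $G$; equivalently $\bigcap_{k\ge1}\gamma_k(G)=1$. *)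

theory Defs
  imports
    "HOL-Analysis.Determinants"
    "HOL-Algebra.Bij"
    "HOL-Algebra.Elementary_Groups"
begin

section \<open>Residually nilpotent groups\<close>

text \<open>The indexing is shifted: \<open>lower_central G n\<close> is $\gamma_{n+1}(G)$.\<close>

fun lower_central :: "('a, 'b) monoid_scheme \<Rightarrow> nat \<Rightarrow> 'a set" where
  "lower_central G 0 = carrier G"
| "lower_central G (Suc n) = generate G
     (\<Union>a \<in> lower_central G n. \<Union>b \<in> carrier G.
        {a \<otimes>\<^bsub>G\<^esub> b \<otimes>\<^bsub>G\<^esub> inv\<^bsub>G\<^esub> a \<otimes>\<^bsub>G\<^esub> inv\<^bsub>G\<^esub> b})"

definition nilpotent_group :: "('a, 'b) monoid_scheme \<Rightarrow> bool" where
  "nilpotent_group G \<longleftrightarrow> group G \<and> (\<exists>n. lower_central G n = {\<one>\<^bsub>G\<^esub>})"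

definition residually_nilpotent :: "('a, 'b) monoid_scheme \<Rightarrow> bool" where
  "residually_nilpotent G \<longleftrightarrow> group G \<and>
     (\<forall>g \<in> carrier G. g \<noteq> \<one>\<^bsub>G\<^esub> \<longrightarrow>
        (\<exists>N. N \<lhd> G \<and> nilpotent_group (G Mod N) \<and> N #>\<^bsub>G\<^esub> g \<noteq> \<one>\<^bsub>G Mod N\<^esub>))"

context group
begin

lemma lower_central_normal: "lower_central G n \<lhd> G"
proof (induction n)
  case 0
  show ?case by (simp add: normal_self)
next
  case (Suc n)
  interpret N: normal "lower_central G n" G by (fact Suc)
  show ?case unfolding lower_central.simps
  proof (rule normal_generateI)
    show "(\<Union>a\<in>lower_central G n. \<Union>b\<in>carrier G. {a \<otimes> b \<otimes> inv a \<otimes> inv b}) \<subseteq> carrier G"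
      using N.subset by auto
  next
    fix h g
    assume "h \<in> (\<Union>a\<in>lower_central G n. \<Union>b\<in>carrier G. {a \<otimes> b \<otimes> inv a \<otimes> inv b})"
      and g: "g \<in> carrier G"
    then obtain a b where a: "a \<in> lower_central G n" and b: "b \<in> carrier G"
      and h: "h = a \<otimes> b \<otimes> inv a \<otimes> inv b" by auto
    have ac: "a \<in> carrier G" using a N.subset by auto
    let ?a = "g \<otimes> a \<otimes> inv g" and ?b = "g \<otimes> b \<otimes> inv g"
    have cancel: "inv g \<otimes> (g \<otimes> c) = c" if "c \<in> carrier G" for c
      using that g by (simp add: m_assoc[symmetric])
    have "g \<otimes> h \<otimes> inv g = ?a \<otimes> ?b \<otimes> inv ?a \<otimes> inv ?b"
      using ac b g by (simp add: h m_assoc inv_mult_group cancel)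
    moreover have "?a \<in> lower_central G n" using a g N.inv_op_closed2 by blast
    moreover have "?b \<in> carrier G" using b g by simp
    ultimately show "g \<otimes> h \<otimes> inv g
        \<in> (\<Union>a\<in>lower_central G n. \<Union>b\<in>carrier G. {a \<otimes> b \<otimes> inv a \<otimes> inv b})"
      by blast
  qed
qed

lemma lower_central_subset: "lower_central G n \<subseteq> carrier G"
  using lower_central_normal normal_imp_subgroup subgroup.subset by blast

end

lemma (in group_hom) lower_central_image:
  assumes "h ` carrier G = carrier H"
  shows "lower_central H n = h ` lower_central G n"
proof (induction n)
  case 0
  show ?case by (simp add: assms)
next
  case (Suc n)
  have sub: "a \<in> carrier G" if "a \<in> lower_central G n" for a
    using that G.lower_central_subset by blast
  let ?K = "\<Union>a\<in>lower_central G n. \<Union>b\<in>carrier G.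
              {a \<otimes>\<^bsub>G\<^esub> b \<otimes>\<^bsub>G\<^esub> inv\<^bsub>G\<^esub> a \<otimes>\<^bsub>G\<^esub> inv\<^bsub>G\<^esub> b}"
  have K: "?K \<subseteq> carrier G" using sub by auto
  have "(\<Union>a\<in>h ` lower_central G n. \<Union>b\<in>h ` carrier G.
            {a \<otimes>\<^bsub>H\<^esub> b \<otimes>\<^bsub>H\<^esub> inv\<^bsub>H\<^esub> a \<otimes>\<^bsub>H\<^esub> inv\<^bsub>H\<^esub> b}) = h ` ?K"
    by (auto simp: image_UN sub)
  then show ?case
    using generate_img[OF K] by (simp add: Suc assms)
qed

lemma (in group) residually_nilpotent_iff:
  "residually_nilpotent G \<longleftrightarrow> (\<Inter>n. lower_central G n) = {\<one>}"
proof -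
  have img: "lower_central (G Mod N) n = (\<lambda>g. N #> g) ` lower_central G n" if "N \<lhd> G" for N n
  proof -
    interpret N: normal N G by fact
    interpret h: group_hom G "G Mod N" "\<lambda>g. N #> g"
      by (intro group_hom.intro group_hom_axioms.intro N.factorgroup_is_group
          N.r_coset_hom_Mod is_group)
    show ?thesis
      by (rule h.lower_central_image) (auto simp: FactGroup_def RCOSETS_def)
  qed
  have one: "\<one> \<in> lower_central G n" for n
    using lower_central_normal[of n] normal_imp_subgroup subgroup.one_closed by blast
  show ?thesis
  proof
    assume R: "residually_nilpotent G"
    have "g = \<one>" if g: "\<And>n. g \<in> lower_central G n" for g
    proof (rule ccontr)
      assume "g \<noteq> \<one>"
      moreover have "g \<in> carrier G" using g[of 0] by simp
      ultimately obtain N where N: "N \<lhd> G" "nilpotent_group (G Mod N)" "N #> g \<noteq> \<one>\<^bsub>G Mod N\<^esub>"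
        using R unfolding residually_nilpotent_def by blast
      then obtain n where "lower_central (G Mod N) n = {\<one>\<^bsub>G Mod N\<^esub>}"
        unfolding nilpotent_group_def by blast
      then show False using img[OF N(1), of n] g[of n] N(3) by blast
    qed
    then show "(\<Inter>n. lower_central G n) = {\<one>}" using one by blast
  next
    assume I: "(\<Inter>n. lower_central G n) = {\<one>}"
    show "residually_nilpotent G"
      unfolding residually_nilpotent_def
    proof (intro conjI ballI impI is_group)
      fix g assume g: "g \<in> carrier G" "g \<noteq> \<one>"
      then obtain n where n: "g \<notin> lower_central G n" using I by blast
      let ?N = "lower_central G n"
      interpret N: normal ?N G by (rule lower_central_normal)
      have "lower_central (G Mod ?N) n = {\<one>\<^bsub>G Mod ?N\<^esub>}"
        unfolding img[OF lower_central_normal] one_FactGroup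
        using image_constant[OF one[of n]] N.rcos_const[OF is_group] by (simp cong: image_cong)
      then have "nilpotent_group (G Mod ?N)"
        unfolding nilpotent_group_def using N.factorgroup_is_group by blast
      moreover have "?N #> g \<noteq> \<one>\<^bsub>G Mod ?N\<^esub>"
        using n rcos_self[OF g(1) N.subgroup_axioms] by auto
      ultimately show "\<exists>N. N \<lhd> G \<and> nilpotent_group (G Mod N) \<and> N #> g \<noteq> \<one>\<^bsub>G Mod N\<^esub>"
        using lower_central_normal by blast
    qed
  qed
qed


section \<open>Free groups\<close>

text \<open>The free group on a type \<open>'a\<close> of generators consists of the reduced words in the letters
  \<open>(a, True)\<close>, standing for $a$, and \<open>(a, False)\<close>, standing for $a^{-1}$.\<close>

definition inv_letter :: "'a \<times> bool \<Rightarrow> 'a \<times> bool" where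
  "inv_letter l = (fst l, \<not> snd l)"

definition reduced :: "('a \<times> bool) list \<Rightarrow> bool" where
  "reduced w \<longleftrightarrow> successively (\<lambda>l m. m \<noteq> inv_letter l) w"

fun push_letter :: "'a \<times> bool \<Rightarrow> ('a \<times> bool) list \<Rightarrow> ('a \<times> bool) list" where
  "push_letter l [] = [l]"
| "push_letter l (m # w) = (if m = inv_letter l then w else l # m # w)"

definition free_group :: "('a \<times> bool) list monoid" where
  "free_group = \<lparr>carrier = {w. reduced w}, monoid.mult = (\<lambda>u v. foldr push_letter u v), one = []\<rparr>"

definition free_gen :: "'a \<Rightarrow> ('a \<times> bool) list" where
  "free_gen a = [(a, True)]"

lemma inv_letter_inv_letter [simp]: "inv_letter (inv_letter l) = l"
  by (simp add: inv_letter_def)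

lemma inv_letter_neq [simp]: "inv_letter l \<noteq> l" "l \<noteq> inv_letter l"
  by (cases l; simp add: inv_letter_def)+

lemma reduced_Nil [simp]: "reduced []"
  by (simp add: reduced_def)

lemma reduced_Cons: "reduced (l # w) \<longleftrightarrow> w = [] \<or> hd w \<noteq> inv_letter l \<and> reduced w"
  by (auto simp: reduced_def successively_Cons)

lemma reduced_ConsD: "reduced (l # w) \<Longrightarrow> reduced w"
  by (auto simp: reduced_Cons)

lemma reduced_push_letter: "reduced w \<Longrightarrow> reduced (push_letter l w)"
  by (cases "(l, w)" rule: push_letter.cases) (auto simp: reduced_Cons)

lemma reduced_foldr_push: "reduced v \<Longrightarrow> reduced (foldr push_letter u v)"
  by (induction u) (auto intro: reduced_push_letter)

lemma push_letter_reduced: "reduced (l # w) \<Longrightarrow> push_letter l w = l # w"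
  by (cases w) (auto simp: reduced_Cons)

lemma push_letter_cancel: "reduced w \<Longrightarrow> push_letter l (push_letter (inv_letter l) w) = w"
  by (cases w) (auto simp: push_letter_reduced)

lemma foldr_push_push:
  assumes "reduced w"
  shows "foldr push_letter (push_letter l v) w = push_letter l (foldr push_letter v w)"
proof (cases v)
  case (Cons m v')
  show ?thesis
    using push_letter_cancel[OF reduced_foldr_push[OF assms], of l v'] by (simp add: Cons)
qed simp

lemma foldr_push_assoc:
  assumes "reduced w"
  shows "foldr push_letter (foldr push_letter u v) w = foldr push_letter u (foldr push_letter v w)"
  by (induction u) (simp_all add: foldr_push_push[OF assms])

lemma foldr_push_Nil: "reduced u \<Longrightarrow> foldr push_letter u [] = u"
proof (induction u)
  case (Cons l u)
  then show ?case using reduced_ConsD[OF Cons.prems] push_letter_reduced[OF Cons.prems] by simp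
qed simp

lemma foldr_push_inverse: "foldr push_letter (rev (map inv_letter u)) u = []"
proof -
  have "foldr push_letter (rev (map inv_letter u)) (u @ w) = w" for w
    by (induction u arbitrary: w) (auto simp: foldr_append)
  from this[of "[]"] show ?thesis by simp
qed

lemma reduced_inverse: "reduced u \<Longrightarrow> reduced (rev (map inv_letter u))"
  unfolding reduced_def successively_rev successively_map
  by (erule successively_mono) (metis inv_letter_inv_letter)

lemma carrier_free_group: "w \<in> carrier free_group \<longleftrightarrow> reduced w"
  and mult_free_group: "u \<otimes>\<^bsub>free_group\<^esub> v = foldr push_letter u v"
  and one_free_group: "\<one>\<^bsub>free_group\<^esub> = []"
  by (simp_all add: free_group_def)

lemmas free_group_simps = carrier_free_group mult_free_group one_free_group

lemma group_free_group: "group (free_group :: ('a \<times> bool) list monoid)"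
proof (rule groupI)
  fix u :: "('a \<times> bool) list" assume "u \<in> carrier free_group"
  then show "\<exists>v\<in>carrier free_group. v \<otimes>\<^bsub>free_group\<^esub> u = \<one>\<^bsub>free_group\<^esub>"
    by (intro bexI[of _ "rev (map inv_letter u)"])
      (auto simp: free_group_simps foldr_push_inverse reduced_inverse)
qed (auto simp: free_group_simps reduced_foldr_push foldr_push_assoc)

lemma free_gen_closed [simp]: "free_gen a \<in> carrier free_group"
  by (simp add: free_group_simps free_gen_def reduced_Cons)

lemma inv_free_gen: "inv\<^bsub>free_group\<^esub> free_gen a = [(a, False)]"
  by (rule group.inv_equality[OF group_free_group])
    (auto simp: free_group_simps free_gen_def reduced_Cons inv_letter_def)

text \<open>Induction over left multiplication by generators and their inverses.\<close>

lemma free_group_induct [consumes 1, case_names one mult_gen mult_inv_gen]: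
  assumes w: "w \<in> carrier free_group"
    and 1: "P \<one>\<^bsub>free_group\<^esub>"
    and 2: "\<And>a w. w \<in> carrier free_group \<Longrightarrow> P w \<Longrightarrow> P (free_gen a \<otimes>\<^bsub>free_group\<^esub> w)"
    and 3: "\<And>a w. w \<in> carrier free_group \<Longrightarrow> P w \<Longrightarrow> P (inv\<^bsub>free_group\<^esub> free_gen a \<otimes>\<^bsub>free_group\<^esub> w)"
  shows "P w"
  using w
proof (induction w)
  case Nil
  then show ?case using 1 by (simp add: free_group_simps)
next
  case (Cons l w)
  then have r: "w \<in> carrier free_group" and e: "push_letter l w = l # w"
    by (auto simp: free_group_simps push_letter_reduced dest: reduced_ConsD)
  obtain a b where l: "l = (a, b)" by (cases l)
  have "P (push_letter l w)"
    using 2[OF r Cons.IH[OF r], of a] 3[OF r Cons.IH[OF r], of a]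
    by (cases b) (simp_all add: l inv_free_gen mult_free_group, simp add: free_gen_def)
  then show ?case using e by simp
qed

text \<open>The universal property.\<close>

definition free_lift :: "('b, 'c) monoid_scheme \<Rightarrow> ('a \<Rightarrow> 'b) \<Rightarrow> ('a \<times> bool) list \<Rightarrow> 'b" where
  "free_lift H f w =
     foldr (\<lambda>l h. (if snd l then f (fst l) else inv\<^bsub>H\<^esub> f (fst l)) \<otimes>\<^bsub>H\<^esub> h) w \<one>\<^bsub>H\<^esub>"

lemma free_lift_hom:
  assumes "group H" and f: "range f \<subseteq> carrier H"
  shows "free_lift H f \<in> hom free_group H" and "free_lift H f (free_gen a) = f a"
proof -
  interpret H: group H by fact
  have f': "f a \<in> carrier H" for a using f by auto
  have closed: "free_lift H f w \<in> carrier H" for w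
    by (induction w) (auto simp: free_lift_def f')
  have push: "free_lift H f (push_letter l w) =
      (if snd l then f (fst l) else inv\<^bsub>H\<^esub> f (fst l)) \<otimes>\<^bsub>H\<^esub> free_lift H f w" for l w
  proof (cases "\<exists>v. w = inv_letter l # v")
    case True
    then obtain v where w: "w = inv_letter l # v" by blast
    have "free_lift H f w =
        (if snd l then inv\<^bsub>H\<^esub> f (fst l) else f (fst l)) \<otimes>\<^bsub>H\<^esub> free_lift H f v"
      by (simp add: w free_lift_def inv_letter_def)
    moreover have "f a \<otimes>\<^bsub>H\<^esub> (inv\<^bsub>H\<^esub> f a \<otimes>\<^bsub>H\<^esub> x) = x"
        "inv\<^bsub>H\<^esub> f a \<otimes>\<^bsub>H\<^esub> (f a \<otimes>\<^bsub>H\<^esub> x) = x" if "x \<in> carrier H" for a x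
      using that f'[of a] by (simp_all flip: H.m_assoc)
    ultimately show ?thesis
      using closed[of v] by (simp add: w)
  next
    case False
    then have "push_letter l w = l # w" by (cases w) auto
    then show ?thesis by (simp add: free_lift_def)
  qed
  have "free_lift H f (foldr push_letter u v) = free_lift H f u \<otimes>\<^bsub>H\<^esub> free_lift H f v" for u v
  proof (induction u)
    case Nil
    then show ?case using closed by (simp add: free_lift_def[of H f "[]"])
  next
    case (Cons l u)
    have "free_lift H f (l # u) =
        (if snd l then f (fst l) else inv\<^bsub>H\<^esub> f (fst l)) \<otimes>\<^bsub>H\<^esub> free_lift H f u"
      by (simp add: free_lift_def)
    then show ?case using closed f' by (simp add: push Cons H.m_assoc)
  qed
  then show "free_lift H f \<in> hom free_group H"
    using closed by (auto simp: hom_def free_group_simps)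
  show "free_lift H f (free_gen a) = f a"
    using f' by (simp add: free_lift_def free_gen_def)
qed

lemma free_group_hom_unique:
  assumes "group H" "h \<in> hom free_group H" "k \<in> hom free_group H"
    and "\<And>a. h (free_gen a) = k (free_gen a)" and "w \<in> carrier free_group"
  shows "h w = k w"
proof -
  interpret h: group_hom free_group H h
    by (intro group_hom.intro group_hom_axioms.intro group_free_group assms)
  interpret k: group_hom free_group H k
    by (intro group_hom.intro group_hom_axioms.intro group_free_group assms)
  show ?thesis
    using assms(5) by (induction rule: free_group_induct) (simp_all add: assms(4))
qed

text \<open>The generators are indexed by the two-element type \<open>2\<close>, which is also the index type of
  $2\times 2$ matrices.\<close>

abbreviation F2 :: "(2 \<times> bool) list monoid" where
  "F2 \<equiv> free_group"


section \<open>The automorphism induced on the abelianization\<close>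

definition abelianization :: "('a, 'b) monoid_scheme \<Rightarrow> 'a set monoid" where
  "abelianization G = G Mod derived G (carrier G)"

definition ab_class :: "('a, 'b) monoid_scheme \<Rightarrow> 'a \<Rightarrow> 'a set" where
  "ab_class G g = derived G (carrier G) #>\<^bsub>G\<^esub> g"

text \<open>Elements of the abelianization are cosets, and an automorphism acts on them by taking
  images; see \<open>induced_ab_class\<close>.\<close>

definition induced_ab :: "('a \<Rightarrow> 'a) \<Rightarrow> 'a set \<Rightarrow> 'a set" where
  "induced_ab \<phi> C = \<phi> ` C"

lemma (in group) induced_ab_class:
  assumes "\<phi> \<in> auto G" "g \<in> carrier G"
  shows "induced_ab \<phi> (ab_class G g) = ab_class G (\<phi> g)"
proof -
  interpret group_hom G G \<phi>
    using assms(1) by (intro group_hom.intro group_hom_axioms.intro is_group) (simp add: auto_def)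
  have "\<phi> ` carrier G = carrier G"
    using assms(1) by (simp add: auto_def Bij_def bij_betw_def)
  then have D: "\<phi> ` derived G (carrier G) = derived G (carrier G)"
    using derived_img[OF subset_refl] by simp
  have "\<phi> ` (derived G (carrier G) #>\<^bsub>G\<^esub> g) = \<phi> ` derived G (carrier G) #>\<^bsub>G\<^esub> \<phi> g"
    unfolding r_coset_def image_UN using derived_in_carrier[of "carrier G"] assms(2)
    by (intro equalityI subsetI) (auto simp: subset_iff)
  then show ?thesis by (simp add: induced_ab_def ab_class_def D)
qed

text \<open>\<open>M\<close> represents an endomorphism of $F_2^{ab}$, in the basis given by the classes of the two
  free generators; as usual the columns of \<open>M\<close> are the coordinates of the images of the basis.\<close>

definition represents_ab :: "int^2^2 \<Rightarrow> ((2 \<times> bool) list set \<Rightarrow> (2 \<times> bool) list set) \<Rightarrow> bool" where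
  "represents_ab M f \<longleftrightarrow>
     (\<forall>j. f (ab_class F2 (free_gen j)) =
        (ab_class F2 (free_gen 1) [^]\<^bsub>abelianization F2\<^esub> (M $ 1 $ j))
        \<otimes>\<^bsub>abelianization F2\<^esub>
        (ab_class F2 (free_gen 2) [^]\<^bsub>abelianization F2\<^esub> (M $ 2 $ j)))"

definition ab_matrix :: "((2 \<times> bool) list \<Rightarrow> (2 \<times> bool) list) \<Rightarrow> int^2^2" where
  "ab_matrix \<phi> = (THE M. represents_ab M (induced_ab \<phi>))"

lemma group_hom_ab_class:
  assumes "group G"
  shows "group_hom G (abelianization G) (ab_class G)"
proof -
  interpret group G by fact
  interpret N: normal "derived G (carrier G)" G by (rule derived_self_is_normal)
  show ?thesis
    unfolding abelianization_def ab_class_def[abs_def]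
    by (intro group_hom.intro group_hom_axioms.intro is_group
        N.r_coset_hom_Mod N.factorgroup_is_group)
qed

lemma ab_class_coordinates:
  assumes "w \<in> carrier F2"
  shows "\<exists>(a::int) (b::int). ab_class F2 w =
     ab_class F2 (free_gen 1) [^]\<^bsub>abelianization F2\<^esub> a \<otimes>\<^bsub>abelianization F2\<^esub>
     ab_class F2 (free_gen 2) [^]\<^bsub>abelianization F2\<^esub> b"
proof -
  interpret A: comm_group "abelianization F2"
    unfolding abelianization_def by (rule group.derived_quot_is_comm_group[OF group_free_group])
  interpret c: group_hom F2 "abelianization F2" "ab_class F2"
    by (rule group_hom_ab_class[OF group_free_group])
  let ?x = "ab_class F2 (free_gen 1)" and ?y = "ab_class F2 (free_gen 2)"
  have cl: "?x \<in> carrier (abelianization F2)" "?y \<in> carrier (abelianization F2)"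
    by (auto intro: c.hom_closed)
  let ?e = "\<lambda>(a::int) (b::int). ?x [^]\<^bsub>abelianization F2\<^esub> a \<otimes>\<^bsub>abelianization F2\<^esub> ?y [^]\<^bsub>abelianization F2\<^esub> b"
  have mult: "?e a b \<otimes>\<^bsub>abelianization F2\<^esub> ?e a' b' = ?e (a + a') (b + b')" for a b a' b'
  proof -
    have "?e (a + a') (b + b') =
        (?x [^]\<^bsub>abelianization F2\<^esub> a \<otimes>\<^bsub>abelianization F2\<^esub> ?x [^]\<^bsub>abelianization F2\<^esub> a')
        \<otimes>\<^bsub>abelianization F2\<^esub>
        (?y [^]\<^bsub>abelianization F2\<^esub> b \<otimes>\<^bsub>abelianization F2\<^esub> ?y [^]\<^bsub>abelianization F2\<^esub> b')"
      by (simp only: A.int_pow_mult[OF cl(1)] A.int_pow_mult[OF cl(2)])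
    also have "\<dots> = ?e a b \<otimes>\<^bsub>abelianization F2\<^esub> ?e a' b'"
      by (simp only: A.m_ac A.m_closed A.int_pow_closed cl)
    finally show ?thesis by simp
  qed
  have inv: "inv\<^bsub>abelianization F2\<^esub> ?e a b = ?e (- a) (- b)" for a b
    by (simp only: A.inv_mult A.int_pow_closed A.int_pow_neg cl)
  have gen: "\<exists>a b. ab_class F2 (free_gen j) = ?e a b" for j :: 2
  proof (cases "j = 1")
    case True
    then show ?thesis using cl by (intro exI[of _ 1] exI[of _ 0]) simp
  next
    case False
    then have "j = 2" using exhaust_2[of j] by simp
    then show ?thesis using cl by (intro exI[of _ 0] exI[of _ 1]) simp
  qed
  show ?thesis
    using assms
  proof (induction rule: free_group_induct)
    case one
    have "ab_class F2 \<one>\<^bsub>F2\<^esub> = ?e 0 0" using cl by simp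
    then show ?case by blast
  next
    case (mult_gen j w)
    obtain a b where 1: "ab_class F2 w = ?e a b" using mult_gen by blast
    obtain a' b' where 2: "ab_class F2 (free_gen j) = ?e a' b'" using gen by blast
    have "ab_class F2 (free_gen j \<otimes>\<^bsub>F2\<^esub> w) = ?e (a' + a) (b' + b)"
      using mult_gen(1) by (simp only: c.hom_mult free_gen_closed 1 2 mult)
    then show ?case by blast
  next
    case (mult_inv_gen j w)
    obtain a b where 1: "ab_class F2 w = ?e a b" using mult_inv_gen by blast
    obtain a' b' where 2: "ab_class F2 (free_gen j) = ?e a' b'" using gen by blast
    have "ab_class F2 (inv\<^bsub>F2\<^esub> free_gen j \<otimes>\<^bsub>F2\<^esub> w) = ?e (- a' + a) (- b' + b)"
      using mult_inv_gen(1)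
      by (simp only: c.hom_mult c.hom_inv c.G.inv_closed free_gen_closed 1 2 mult inv)
    then show ?case by blast
  qed
qed

definition exponent_sum :: "'a \<Rightarrow> ('a \<times> bool) list \<Rightarrow> int" where
  "exponent_sum i = free_lift integer_group (\<lambda>j. if j = i then 1 else 0)"

lemma group_hom_exponent_sum: "group_hom free_group integer_group (exponent_sum i)"
  unfolding exponent_sum_def
  by (intro group_hom.intro group_hom_axioms.intro group_free_group group_integer_group
      free_lift_hom) auto

lemma exponent_sum_free_gen: "exponent_sum i (free_gen j) = (if j = i then 1 else 0)"
  unfolding exponent_sum_def by (simp add: free_lift_hom)

lemma exponent_sum_cong:
  assumes "ab_class free_group u = ab_class free_group v"
    and "u \<in> carrier free_group" "v \<in> carrier free_group"
  shows "exponent_sum i u = exponent_sum i v"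
proof -
  interpret e: group_hom free_group integer_group "exponent_sum i"
    by (rule group_hom_exponent_sum)
  have "derived free_group (carrier free_group) \<subseteq> kernel free_group integer_group (exponent_sum i)"
    unfolding derived_def
  proof (rule e.G.generate_subgroup_incl[OF _ e.subgroup_kernel])
    show "derived_set free_group (carrier free_group) \<subseteq> kernel free_group integer_group (exponent_sum i)"
      by (auto simp: kernel_def)
  qed
  moreover have "u \<in> derived free_group (carrier free_group) #>\<^bsub>free_group\<^esub> v"
    using assms e.G.rcos_self[OF assms(2) e.G.derived_is_subgroup[of "carrier free_group"]]
    by (simp add: ab_class_def)
  then obtain d where "d \<in> derived free_group (carrier free_group)"
    "u = d \<otimes>\<^bsub>free_group\<^esub> v" by (auto simp: r_coset_def)
  ultimately show ?thesis using assms(3) by (auto simp: kernel_def)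
qed

lemma represents_ab_ab_matrix:
  assumes "\<phi> \<in> auto F2"
  shows "\<exists>!M. represents_ab M (induced_ab \<phi>)"
    and "represents_ab (ab_matrix \<phi>) (induced_ab \<phi>)"
    and "ab_matrix \<phi> $ i $ j = exponent_sum i (\<phi> (free_gen j))"
proof -
  interpret c: group_hom F2 "abelianization F2" "ab_class F2"
    by (rule group_hom_ab_class[OF group_free_group])
  have closed: "\<phi> (free_gen j) \<in> carrier F2" for j
    using assms free_gen_closed[of j] unfolding auto_def hom_def by blast
  have ind: "induced_ab \<phi> (ab_class F2 (free_gen j)) = ab_class F2 (\<phi> (free_gen j))" for j
    by (rule group.induced_ab_class[OF group_free_group assms]) simp
  have ex: "\<exists>M. represents_ab M (induced_ab \<phi>)"
  proof -
    obtain a b :: "2 \<Rightarrow> int" where ab: "\<And>j. ab_class F2 (\<phi> (free_gen j)) =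
       ab_class F2 (free_gen 1) [^]\<^bsub>abelianization F2\<^esub> a j \<otimes>\<^bsub>abelianization F2\<^esub>
       ab_class F2 (free_gen 2) [^]\<^bsub>abelianization F2\<^esub> b j"
      using ab_class_coordinates[OF closed] by metis
    show ?thesis
      by (rule exI[of _ "\<chi> i j. if i = 1 then a j else b j"]) (simp add: represents_ab_def ind ab)
  qed
  have entry: "M $ i $ j = exponent_sum i (\<phi> (free_gen j))"
    if "represents_ab M (induced_ab \<phi>)" for M i j
  proof -
    interpret e: group_hom F2 integer_group "exponent_sum i" by (rule group_hom_exponent_sum)
    let ?w = "free_gen 1 [^]\<^bsub>F2\<^esub> (M $ 1 $ j) \<otimes>\<^bsub>F2\<^esub> free_gen 2 [^]\<^bsub>F2\<^esub> (M $ 2 $ j)"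
    have "ab_class F2 (\<phi> (free_gen j)) = ab_class F2 ?w"
      using that by (simp add: represents_ab_def ind c.hom_int_pow)
    then have "exponent_sum i (\<phi> (free_gen j)) = exponent_sum i ?w"
      by (rule exponent_sum_cong) (auto simp: closed)
    also have "\<dots> = M $ i $ j"
      using exhaust_2[of i] by (auto simp: e.hom_int_pow exponent_sum_free_gen)
    finally show ?thesis by simp
  qed
  show ex1: "\<exists>!M. represents_ab M (induced_ab \<phi>)"
    using ex by (rule ex_ex1I) (simp add: vec_eq_iff entry)
  show "represents_ab (ab_matrix \<phi>) (induced_ab \<phi>)"
    unfolding ab_matrix_def by (rule theI'[OF ex1])
  then show "ab_matrix \<phi> $ i $ j = exponent_sum i (\<phi> (free_gen j))"
    by (rule entry)
qed


section \<open>Semidirect products with the integers\<close>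

text \<open>The pair \<open>(m, u)\<close> stands for $t^m u$; the multiplication rule comes from
  $t^m u\, t^n v = t^{m+n} (t^{-n} u t^n) v$ and $t^{-1} u t = \varphi(u)$.\<close>

definition semidirect_int :: "('a, 'b) monoid_scheme \<Rightarrow> ('a \<Rightarrow> 'a) \<Rightarrow> (int \<times> 'a) monoid" where
  "semidirect_int G \<phi> = \<lparr>carrier = UNIV \<times> carrier G,
     monoid.mult = (\<lambda>(m, u) (n, v). (m + n, (\<phi> [^]\<^bsub>AutoGroup G\<^esub> n) u \<otimes>\<^bsub>G\<^esub> v)),
     one = (0, \<one>\<^bsub>G\<^esub>)\<rparr>"

lemma (in group)
  assumes "\<phi> \<in> auto G"
  shows group_semidirect_int: "group (semidirect_int G \<phi>)"
    and semidirect_int_conj: "u \<in> carrier G \<Longrightarrow>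
      inv\<^bsub>semidirect_int G \<phi>\<^esub> (1, \<one>\<^bsub>G\<^esub>) \<otimes>\<^bsub>semidirect_int G \<phi>\<^esub> (0, u)
        \<otimes>\<^bsub>semidirect_int G \<phi>\<^esub> (1, \<one>\<^bsub>G\<^esub>) = (0, \<phi> u)"
    and semidirect_int_eq: "u \<in> carrier G \<Longrightarrow>
      (1, \<one>\<^bsub>G\<^esub>) [^]\<^bsub>semidirect_int G \<phi>\<^esub> m \<otimes>\<^bsub>semidirect_int G \<phi>\<^esub> (0, u) = (m, u)"
proof -
  interpret A: group "AutoGroup G" by (rule AutoGroup)
  have cA: "carrier (AutoGroup G) = auto G"
    by (simp add: AutoGroup_def)
  let ?p = "\<lambda>n::int. \<phi> [^]\<^bsub>AutoGroup G\<^esub> n"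
  have \<phi>A: "\<phi> \<in> carrier (AutoGroup G)" using assms by (simp add: cA)
  have p: "?p n \<in> auto G" for n
    using A.int_pow_closed[OF \<phi>A] by (simp add: cA)
  have hom: "?p n \<in> hom G G" for n using p by (simp add: auto_def)
  have closed: "?p n u \<in> carrier G" if "u \<in> carrier G" for n u
    using hom[of n] that by (auto simp: hom_def)
  have mult: "?p n (u \<otimes> v) = ?p n u \<otimes> ?p n v" if "u \<in> carrier G" "v \<in> carrier G" for n u v
    using hom[of n] that by (auto simp: hom_def)
  have one: "?p n \<one> = \<one>" for n
    using hom[of n] by (rule hom_one) (rule is_group)+
  have zero: "?p 0 u = u" if "u \<in> carrier G" for u
    using that by (simp add: AutoGroup_def BijGroup_def)
  have p1: "?p 1 = \<phi>" using \<phi>A by simp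
  have pp: "?p (m + n) u = ?p m (?p n u)" if "u \<in> carrier G" for m n u
  proof -
    have "?p (m + n) = ?p m \<otimes>\<^bsub>AutoGroup G\<^esub> ?p n" by (rule A.int_pow_mult[OF \<phi>A])
    also have "\<dots> = compose (carrier G) (?p m) (?p n)"
      using p[of m] p[of n] by (simp add: AutoGroup_def BijGroup_def auto_def)
    finally show ?thesis using that by (simp add: compose_eq)
  qed
  note S = semidirect_int_def
  show grp: "group (semidirect_int G \<phi>)"
  proof (rule groupI)
    fix x y z
    assume "x \<in> carrier (semidirect_int G \<phi>)" "y \<in> carrier (semidirect_int G \<phi>)"
      "z \<in> carrier (semidirect_int G \<phi>)"
    then show "x \<otimes>\<^bsub>semidirect_int G \<phi>\<^esub> y \<otimes>\<^bsub>semidirect_int G \<phi>\<^esub> z =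
        x \<otimes>\<^bsub>semidirect_int G \<phi>\<^esub> (y \<otimes>\<^bsub>semidirect_int G \<phi>\<^esub> z)"
      by (auto simp: S closed mult pp[symmetric] m_assoc add_ac)
  next
    fix x assume "x \<in> carrier (semidirect_int G \<phi>)"
    then obtain m u where x: "x = (m, u)" "u \<in> carrier G" by (auto simp: S)
    have "?p m (?p (- m) (inv u)) = inv u"
      using pp[of "inv u" m "- m"] zero x by simp
    then show "\<exists>y\<in>carrier (semidirect_int G \<phi>).
        y \<otimes>\<^bsub>semidirect_int G \<phi>\<^esub> x = \<one>\<^bsub>semidirect_int G \<phi>\<^esub>"
      using x by (intro bexI[of _ "(- m, ?p (- m) (inv u))"]) (auto simp: S closed)
  qed (auto simp: S closed one)
  interpret S: group "semidirect_int G \<phi>" by fact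
  have inv_t: "inv\<^bsub>semidirect_int G \<phi>\<^esub> (1, \<one>) = (- 1, \<one>)"
    by (rule S.inv_equality) (auto simp: S one)
  show "inv\<^bsub>semidirect_int G \<phi>\<^esub> (1, \<one>) \<otimes>\<^bsub>semidirect_int G \<phi>\<^esub> (0, u)
      \<otimes>\<^bsub>semidirect_int G \<phi>\<^esub> (1, \<one>) = (0, \<phi> u)" if "u \<in> carrier G"
    unfolding inv_t using that closed[of u 1] by (simp add: S one zero p1 del: A.int_pow_1)
  have t_pow: "(1, \<one>) [^]\<^bsub>semidirect_int G \<phi>\<^esub> n = (int n, \<one>)" for n :: nat
    by (induction n) (auto simp: S one)
  have "(1, \<one>) [^]\<^bsub>semidirect_int G \<phi>\<^esub> m = (m, \<one>)"
  proof (cases m rule: int_cases2)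
    case (nonneg n)
    then show ?thesis by (simp add: int_pow_int t_pow)
  next
    case (nonpos n)
    have "inv\<^bsub>semidirect_int G \<phi>\<^esub> (int n, \<one>) = (- int n, \<one>)"
      by (rule S.inv_equality) (auto simp: S one)
    moreover have "(1, \<one>) \<in> carrier (semidirect_int G \<phi>)" by (simp add: S)
    ultimately show ?thesis
      by (simp add: nonpos S.int_pow_neg int_pow_int t_pow)
  qed
  then show "(1, \<one>) [^]\<^bsub>semidirect_int G \<phi>\<^esub> m \<otimes>\<^bsub>semidirect_int G \<phi>\<^esub> (0, u) = (m, u)"
    if "u \<in> carrier G" using that by (simp add: S one zero)
qed

end

theory Submission
  imports Defs "HOL-Computational_Algebra.Primes"
begin

text \<open>
  Since $\det(\overline\varphi - 1) = 2 - \mathrm{tr}$, for trace 1 or 3 the map $\overline\varphi - 1$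
  is onto, so $F_2$ equals $[F_2, G]$ and lies in every term of the lower central series.
  Otherwise some prime $p$ divides $2 - \mathrm{tr}$, hence $(\overline\varphi - 1)^2 = 0$ modulo
  $p$ and $\varphi^p$ acts trivially on $F_2^{ab} \otimes \mathbb{F}_p$.  Integer functions on $G$
  killed modulo $q$ by all products of sufficiently many operators $g - 1$ do not distinguish an
  element of a late term of the lower central series from $1$.  Starting from
  the functions on $F_2$ killed by a power of the ideal generated by $p$ and all $v - 1$, with
  $q = p^k$, the operator $(\varphi - 1)^p$ agrees modulo $p$ with $\varphi^p - 1$ and so lowers the
  degree; therefore these functions have the required property on $G$ too.  They separate
  points, because $F_2$ embeds into the matrices in $\mathrm{SL}_2(\mathbb{Z})$ congruent to $1$
  modulo $p$.
\<close>

section \<open>Polynomial functions on a group\<close>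

text \<open>The operator v - 1, where group elements act on functions by right translation; below it
  is written D_v.\<close>

definition right_diff :: "('a, 'b) monoid_scheme \<Rightarrow> 'a \<Rightarrow> ('a \<Rightarrow> int) \<Rightarrow> 'a \<Rightarrow> int" where
  "right_diff G v f u = f (u \<otimes>\<^bsub>G\<^esub> v) - f u"

text \<open>The degree filtration by powers of the ideal $(p, \Delta)$ of $(\mathbb{Z}/q)[G]$,
  where $\Delta$ is the augmentation ideal; for \<open>p = 0\<close> it is the filtration by powers of $\Delta$.
  Degree \<open>d\<close> here means killed by the \<open>d\<close>-th power.\<close>

fun poly_fn :: "('a, 'b) monoid_scheme \<Rightarrow> int \<Rightarrow> int \<Rightarrow> nat \<Rightarrow> ('a \<Rightarrow> int) \<Rightarrow> bool" where
  "poly_fn G p q 0 f \<longleftrightarrow> (\<forall>u\<in>carrier G. q dvd f u)"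
| "poly_fn G p q (Suc d) f \<longleftrightarrow>
     poly_fn G p q d (\<lambda>u. p * f u) \<and> (\<forall>v\<in>carrier G. poly_fn G p q d (right_diff G v f))"

section \<open>Closure properties of the degree filtration\<close>

lemma poly_fn_add:
  "poly_fn G p q d f \<Longrightarrow> poly_fn G p q d g \<Longrightarrow> poly_fn G p q d (\<lambda>u. f u + g u)"
proof (induction d arbitrary: f g)
  case (Suc d)
  have "poly_fn G p q d (\<lambda>u. p * f u + p * g u)"
    using Suc by simp
  moreover have "poly_fn G p q d (\<lambda>u. right_diff G v f u + right_diff G v g u)" if "v \<in> carrier G" for v
    using Suc that by simp
  moreover have "right_diff G v (\<lambda>u. f u + g u) = (\<lambda>u. right_diff G v f u + right_diff G v g u)" for v
    by (auto simp: right_diff_def)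
  ultimately show ?case by (simp add: ring_distribs)
qed simp

lemma poly_fn_scale: "poly_fn G p q d f \<Longrightarrow> poly_fn G p q d (\<lambda>u. c * f u)"
proof (induction d arbitrary: f)
  case (Suc d)
  have "poly_fn G p q d (\<lambda>u. c * (p * f u))"
    using Suc by simp
  moreover have "poly_fn G p q d (\<lambda>u. c * right_diff G v f u)" if "v \<in> carrier G" for v
    using Suc that by simp
  moreover have "right_diff G v (\<lambda>u. c * f u) = (\<lambda>u. c * right_diff G v f u)" for v
    by (auto simp: right_diff_def algebra_simps)
  ultimately show ?case by (simp add: mult.left_commute)
qed simp

lemma poly_fn_diff:
  "poly_fn G p q d f \<Longrightarrow> poly_fn G p q d g \<Longrightarrow> poly_fn G p q d (\<lambda>u. f u - g u)"
  using poly_fn_add[of G p q d f "\<lambda>u. (-1) * g u"] poly_fn_scale[of G p q d g "-1"] by simp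

lemma poly_fn_zero: "poly_fn G p q d (\<lambda>u. 0)"
proof (induction d)
  case (Suc d)
  have "right_diff G v (\<lambda>u. 0) = (\<lambda>u. 0)" for v by (auto simp: right_diff_def)
  then show ?case using Suc by simp
qed simp

lemma poly_fn_sum:
  "(\<And>i. i \<in> I \<Longrightarrow> poly_fn G p q d (f i)) \<Longrightarrow> poly_fn G p q d (\<lambda>u. \<Sum>i\<in>I. f i u)"
  by (induction I rule: infinite_finite_induct) (simp_all add: poly_fn_zero poly_fn_add)

context group
begin

lemma poly_fn_cong:
  assumes "\<And>u. u \<in> carrier G \<Longrightarrow> f u = g u" "poly_fn G p q d f"
  shows "poly_fn G p q d g"
  using assms
proof (induction d arbitrary: f g)
  case (Suc d)
  have "poly_fn G p q d (\<lambda>u. p * g u)"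
    by (rule Suc.IH[of "\<lambda>u. p * f u"]) (use Suc.prems in auto)
  moreover have "poly_fn G p q d (right_diff G v g)" if "v \<in> carrier G" for v
    by (rule Suc.IH[of "right_diff G v f"])
      (use Suc.prems that in \<open>simp add: right_diff_def\<close>, use Suc.prems that in simp)
  ultimately show ?case by simp
qed simp

lemma poly_fn_Suc: "poly_fn G p q d f \<Longrightarrow> poly_fn G p q (Suc d) f"
proof (induction d arbitrary: f)
  case 0
  then show ?case by (simp add: right_diff_def)
next
  case (Suc d)
  then show ?case by simp
qed

lemma poly_fn_translate:
  assumes "poly_fn G p q d f" "v \<in> carrier G"
  shows "poly_fn G p q d (\<lambda>u. f (u \<otimes> v))"
proof (cases d)
  case (Suc e)
  have "poly_fn G p q e (right_diff G w (\<lambda>u. f (u \<otimes> v)))" if "w \<in> carrier G" for w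
    by (rule poly_fn_cong[of "\<lambda>u. right_diff G (w \<otimes> v) f u - right_diff G v f u"])
      (use assms Suc that in \<open>simp add: right_diff_def m_assoc\<close>,
        use assms Suc that in \<open>simp add: poly_fn_diff\<close>)
  moreover have "poly_fn G p q e (\<lambda>u. p * right_diff G v f u + p * f u)"
    using assms Suc by (intro poly_fn_add poly_fn_scale[of G p q e "right_diff G v f"]) simp_all
  then have "poly_fn G p q e (\<lambda>u. p * f (u \<otimes> v))"
    by (rule poly_fn_cong[rotated]) (simp add: right_diff_def algebra_simps)
  ultimately show ?thesis by (simp add: Suc)
qed (use assms in auto)

text \<open>Differences pass through h: D_v (f o h) = (D_{h v} f) o h.\<close>

lemma poly_fn_hom:
  assumes "h \<in> hom G G" "poly_fn G p q d f"
  shows "poly_fn G p q d (\<lambda>u. f (h u))"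
  using assms(2)
proof (induction d arbitrary: f)
  case (Suc d)
  have h: "h u \<in> carrier G" "h (u \<otimes> v) = h u \<otimes> h v"
    if "u \<in> carrier G" "v \<in> carrier G" for u v
    using assms(1) that by (auto simp: hom_def)
  have "poly_fn G p q d (right_diff G v (\<lambda>u. f (h u)))" if "v \<in> carrier G" for v
    by (rule poly_fn_cong[of "\<lambda>u. right_diff G (h v) f (h u)"])
      (use that h in \<open>simp add: right_diff_def\<close>, use Suc that h[OF that that] in simp)
  moreover have "poly_fn G p q d (\<lambda>u. p * f (h u))"
    using Suc.IH[of "\<lambda>u. p * f u"] Suc.prems by simp
  ultimately show ?case by simp
qed (use assms(1) in \<open>auto simp: hom_def\<close>)

section \<open>Polynomial functions and the lower central series\<close>

text \<open>The inductive step rests on $[a, b] - 1 = ((a-1)(b-1) - (b-1)(a-1))\, a^{-1} b^{-1}$.\<close>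

lemma right_diff_lower_central:
  assumes "a \<in> lower_central G n" "poly_fn G p q (Suc (n + i)) f"
  shows "poly_fn G p q i (right_diff G a f)"
  using assms
proof (induction n arbitrary: a i f)
  case 0
  then show ?case by simp
next
  case (Suc n)
  have nc: "a \<in> carrier G" if "a \<in> lower_central G n" for a
    using that lower_central_subset by blast
  \<comment> \<open>The elements whose difference operator lowers degrees by n + 2 form a subgroup,
    so only the generating commutators have to be examined.\<close>
  define A where "A = {a \<in> carrier G. \<forall>i f. poly_fn G p q (Suc (Suc n + i)) f \<longrightarrow>
      poly_fn G p q i (right_diff G a f)}"
  have "subgroup A G"
  proof (rule subgroupI)
    show "A \<subseteq> carrier G" by (auto simp: A_def)
    have "poly_fn G p q i (right_diff G \<one> f)" for i f
      by (rule poly_fn_cong[OF _ poly_fn_zero]) (simp add: right_diff_def)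
    then show "A \<noteq> {}" by (auto simp: A_def)
  next
    fix a assume a: "a \<in> A"
    then have ac: "a \<in> carrier G" by (simp add: A_def)
    have "poly_fn G p q i (right_diff G (inv a) f)" if "poly_fn G p q (Suc (Suc n + i)) f" for i f
    proof -
      have "poly_fn G p q i (right_diff G a f)"
        using a that by (auto simp: A_def)
      \<comment> \<open>D_{a^-1} f (u) = -(D_a f)(u a^-1).\<close>
      from poly_fn_scale[OF poly_fn_translate[OF this, of "inv a"], of "-1"] show ?thesis
        by (rule poly_fn_cong[rotated]) (use ac in \<open>auto simp: right_diff_def m_assoc\<close>)
    qed
    then show "inv a \<in> A" using ac by (simp add: A_def)
  next
    fix a b assume ab: "a \<in> A" "b \<in> A"
    then have ac: "a \<in> carrier G" and bc: "b \<in> carrier G" by (auto simp: A_def)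
    have "poly_fn G p q i (right_diff G (a \<otimes> b) f)" if f: "poly_fn G p q (Suc (Suc n + i)) f" for i f
    proof -
      have "poly_fn G p q i (right_diff G a f)" "poly_fn G p q i (right_diff G b f)"
        using ab f by (auto simp: A_def)
      \<comment> \<open>D_{ab} f (u) = D_a f (u) + (D_b f)(ua).\<close>
      from poly_fn_add[OF this(1) poly_fn_translate[OF this(2) ac]] show ?thesis
        by (rule poly_fn_cong[rotated]) (use ac bc in \<open>auto simp: right_diff_def m_assoc\<close>)
    qed
    then show "a \<otimes> b \<in> A" using ac bc by (simp add: A_def)
  qed
  moreover have "a \<otimes> b \<otimes> inv a \<otimes> inv b \<in> A"
    if a: "a \<in> lower_central G n" and b: "b \<in> carrier G" for a b
  proof -
    let ?c = "a \<otimes> b \<otimes> inv a \<otimes> inv b"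
    note ac = nc[OF a]
    have "poly_fn G p q i (right_diff G ?c f)" if f: "poly_fn G p q (Suc (Suc n + i)) f" for i f
    proof -
      \<comment> \<open>Translating by a^-1 b^-1 gives D_a D_b g - D_b D_a g = g(uab) - g(uba) =
        f(u[a,b]) - f(u).\<close>
      define g where "g = (\<lambda>u. f (u \<otimes> (inv a \<otimes> inv b)))"
      have g: "poly_fn G p q (Suc (Suc n + i)) g"
        unfolding g_def by (rule poly_fn_translate[OF f]) (simp add: ac b)
      have "poly_fn G p q i (right_diff G a (right_diff G b g))"
        using g b by (intro Suc.IH[OF a]) simp
      moreover have "poly_fn G p q (Suc i) (right_diff G a g)"
        using g by (intro Suc.IH[OF a]) simp
      then have "poly_fn G p q i (right_diff G b (right_diff G a g))"
        using b by simp
      ultimately have "poly_fn G p q i (\<lambda>u. right_diff G a (right_diff G b g) u -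
          right_diff G b (right_diff G a g) u)"
        by (rule poly_fn_diff)
      then show ?thesis
      proof (rule poly_fn_cong[rotated])
        fix u assume u: "u \<in> carrier G"
        have "u \<otimes> b \<otimes> a \<otimes> (inv a \<otimes> inv b) = u"
          using u ac b by (metis inv_closed inv_mult_group m_assoc m_closed r_inv r_one)
        moreover have "u \<otimes> a \<otimes> b \<otimes> (inv a \<otimes> inv b) = u \<otimes> ?c"
          using u ac b by (simp add: m_assoc)
        ultimately show "right_diff G a (right_diff G b g) u -
          right_diff G b (right_diff G a g) u = right_diff G ?c f u"
          by (simp add: right_diff_def g_def)
      qed
    qed
    then show ?thesis using ac b by (simp add: A_def)
  qed
  ultimately have "lower_central G (Suc n) \<subseteq> A"
    unfolding lower_central.simps by (intro generate_subgroup_incl) auto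
  then show ?case using Suc.prems by (auto simp: A_def)
qed

text \<open>If g lies in every term of the lower central series, then D_g f has degree 0 by
  \<open>right_diff_lower_central\<close>; its value at 1 gives f(g) = f(1) modulo q. The data p, q,
  n, f may depend on g.\<close>

lemma residually_nilpotentI:
  assumes "\<And>g. g \<in> carrier G \<Longrightarrow> g \<noteq> \<one> \<Longrightarrow>
      \<exists>p q n f. poly_fn G p q n f \<and> \<not> q dvd f g - f \<one>"
  shows "residually_nilpotent G"
  unfolding residually_nilpotent_iff
proof (intro equalityI subsetI)
  fix g assume g: "g \<in> (\<Inter>n. lower_central G n)"
  then have gc: "g \<in> carrier G" using lower_central_subset by blast
  show "g \<in> {\<one>}"
  proof (rule ccontr)
    assume "g \<notin> {\<one>}"
    then obtain p q n f where f: "poly_fn G p q n f" and nd: "\<not> q dvd f g - f \<one>"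
      using assms[OF gc] by blast
    have "poly_fn G p q 0 (right_diff G g f)"
      using g poly_fn_Suc[OF f] by (intro right_diff_lower_central[of g n]) auto
    then have "q dvd right_diff G g f \<one>" by simp
    then show False using nd gc by (simp add: right_diff_def)
  qed
next
  fix g assume "g \<in> {\<one>}"
  then show "g \<in> (\<Inter>n. lower_central G n)"
    using lower_central_normal normal_imp_subgroup subgroup.one_closed by blast
qed

text \<open>The error is exactly D_v D_w f, so v - 1 is additive in v up to terms two degrees
  lower.\<close>

lemma right_diff_mult:
  assumes "poly_fn G p q (Suc (Suc d)) f" "v \<in> carrier G" "w \<in> carrier G"
  shows "poly_fn G p q d (\<lambda>u. right_diff G (v \<otimes> w) f u - (right_diff G v f u + right_diff G w f u))"
proof -
  have "poly_fn G p q d (right_diff G v (right_diff G w f))" using assms by simp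
  then show ?thesis
    by (rule poly_fn_cong[rotated]) (use assms in \<open>simp add: right_diff_def m_assoc\<close>)
qed

end

section \<open>Extension to the semidirect product\<close>

text \<open>The operator \<phi> - 1, with \<phi> acting on functions by composition.\<close>

definition twist :: "('a \<Rightarrow> 'a) \<Rightarrow> ('a \<Rightarrow> int) \<Rightarrow> 'a \<Rightarrow> int" where
  "twist \<phi> f u = f (\<phi> u) - f u"

lemma funpow_twist_add: "(twist \<phi> ^^ j) (\<lambda>u. f u + g u) = (\<lambda>u. (twist \<phi> ^^ j) f u + (twist \<phi> ^^ j) g u)"
  by (induction j) (auto simp: twist_def)

lemma funpow_twist_diff: "(twist \<phi> ^^ j) (\<lambda>u. f u - g u) = (\<lambda>u. (twist \<phi> ^^ j) f u - (twist \<phi> ^^ j) g u)"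
  by (induction j) (auto simp: twist_def)

text \<open>Binomial expansion of the n-th power of 1 + (\<phi> - 1), by Pascal's rule.\<close>

lemma funpow_eq_sum_twist:
  "f ((\<phi> ^^ n) u) = (\<Sum>k\<le>n. int (n choose k) * (twist \<phi> ^^ k) f u)"
proof (induction n arbitrary: f u)
  case (Suc n)
  let ?B = "\<lambda>k. (twist \<phi> ^^ k) f"
  have B: "?B k (\<phi> u) = ?B k u + ?B (Suc k) u" for k by (simp add: twist_def)
  have "f ((\<phi> ^^ Suc n) u) = (\<Sum>k\<le>n. int (n choose k) * ?B k (\<phi> u))"
    unfolding funpow_Suc_right o_apply by (rule Suc)
  also have "\<dots> = (\<Sum>k\<le>n. int (n choose k) * ?B k u) + (\<Sum>k\<le>n. int (n choose k) * ?B (Suc k) u)"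
    unfolding B by (simp add: ring_distribs sum.distrib)
  \<comment> \<open>The added term has coefficient zero; after the index shift both sums run over
    the same powers.\<close>
  also have "(\<Sum>k\<le>n. int (n choose k) * ?B k u) = (\<Sum>k\<le>Suc n. int (n choose k) * ?B k u)"
    by simp
  also have "\<dots> = ?B 0 u + (\<Sum>k\<le>n. int (n choose Suc k) * ?B (Suc k) u)"
    by (subst sum.atMost_Suc_shift) simp
  finally have "f ((\<phi> ^^ Suc n) u) = ?B 0 u + (\<Sum>k\<le>n. int (Suc n choose Suc k) * ?B (Suc k) u)"
    by (simp add: ring_distribs sum.distrib)
  also have "\<dots> = (\<Sum>k\<le>Suc n. int (Suc n choose k) * ?B k u)"
    by (subst sum.atMost_Suc_shift) simp
  finally show ?case .
qed simp

context group
begin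

text \<open>The equations between values are restricted to the carrier because the unit and product
  of \<open>AutoGroup\<close> are extensional functions on it.\<close>

lemma auto_int_pow:
  assumes "\<phi> \<in> auto G"
  shows "\<phi> [^]\<^bsub>AutoGroup G\<^esub> (n::int) \<in> hom G G"
    and "u \<in> carrier G \<Longrightarrow> (\<phi> [^]\<^bsub>AutoGroup G\<^esub> (0::int)) u = u"
    and "\<phi> [^]\<^bsub>AutoGroup G\<^esub> (1::int) = \<phi>"
    and "u \<in> carrier G \<Longrightarrow> (\<phi> [^]\<^bsub>AutoGroup G\<^esub> (m + n)) u =
      (\<phi> [^]\<^bsub>AutoGroup G\<^esub> m) ((\<phi> [^]\<^bsub>AutoGroup G\<^esub> n) u)"
proof -
  interpret A: group "AutoGroup G" by (rule AutoGroup)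
  have cA: "carrier (AutoGroup G) = auto G"
    by (simp add: AutoGroup_def)
  have \<phi>A: "\<phi> \<in> carrier (AutoGroup G)" using assms by (simp add: cA)
  have p: "\<phi> [^]\<^bsub>AutoGroup G\<^esub> n \<in> auto G" for n :: int
    using A.int_pow_closed[OF \<phi>A] by (simp add: cA)
  then show "\<phi> [^]\<^bsub>AutoGroup G\<^esub> (n::int) \<in> hom G G" by (simp add: auto_def)
  show "(\<phi> [^]\<^bsub>AutoGroup G\<^esub> (0::int)) u = u" if "u \<in> carrier G"
    using that by (simp add: AutoGroup_def BijGroup_def)
  show "\<phi> [^]\<^bsub>AutoGroup G\<^esub> (1::int) = \<phi>" using \<phi>A by simp
  have "\<phi> [^]\<^bsub>AutoGroup G\<^esub> (m + n) =
      compose (carrier G) (\<phi> [^]\<^bsub>AutoGroup G\<^esub> m) (\<phi> [^]\<^bsub>AutoGroup G\<^esub> n)"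
    unfolding A.int_pow_mult[OF \<phi>A]
    using p[of m] p[of n] by (simp add: AutoGroup_def BijGroup_def auto_def)
  then show "(\<phi> [^]\<^bsub>AutoGroup G\<^esub> (m + n)) u =
      (\<phi> [^]\<^bsub>AutoGroup G\<^esub> m) ((\<phi> [^]\<^bsub>AutoGroup G\<^esub> n) u)" if "u \<in> carrier G"
    using that by (simp add: compose_eq)
qed

lemma poly_fn_funpow_twist:
  assumes "\<phi> \<in> hom G G" "poly_fn G p q d f"
  shows "poly_fn G p q d ((twist \<phi> ^^ j) f)"
proof (induction j)
  case (Suc j)
  from poly_fn_diff[OF poly_fn_hom[OF assms(1) Suc] Suc] show ?case
    by (simp add: twist_def[abs_def])
qed (use assms in simp)

text \<open>\<phi>^n - 1 is a multiple of \<phi> - 1: use \<phi>^(n+1) - 1 = \<phi>^n (\<phi> - 1) +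
  (\<phi>^n - 1) and \<phi>^(-n) - 1 = -\<phi>^(-n) (\<phi>^n - 1), where composing with a power of
  \<phi> keeps the degree.\<close>

lemma poly_fn_int_pow_twist:
  assumes \<phi>: "\<phi> \<in> auto G" and f: "poly_fn G p q d (twist \<phi> f)"
  shows "poly_fn G p q d (twist (\<phi> [^]\<^bsub>AutoGroup G\<^esub> (n::int)) f)"
proof -
  let ?T = "\<lambda>n::int. \<phi> [^]\<^bsub>AutoGroup G\<^esub> n"
  note T = auto_int_pow[OF \<phi>]
  have Tc: "?T n u \<in> carrier G" if "u \<in> carrier G" for n u
    using T(1)[of n] that by (auto simp: hom_def)
  have nonneg: "poly_fn G p q d (twist (?T (int n)) f)" for n
  proof (induction n)
    case 0
    show ?case by (rule poly_fn_cong[OF _ poly_fn_zero]) (use T(2) in \<open>simp add: twist_def\<close>)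
  next
    case (Suc n)
    from poly_fn_add[OF poly_fn_hom[OF T(1)[of "int n"] f] Suc] show ?case
    proof (rule poly_fn_cong[rotated])
      fix u assume "u \<in> carrier G"
      then have "?T (int (Suc n)) u = \<phi> (?T (int n) u)"
        using T(4)[of u 1 "int n"] T(3) by (simp add: add.commute)
      then show "twist \<phi> f (?T (int n) u) + twist (?T (int n)) f u = twist (?T (int (Suc n))) f u"
        by (simp add: twist_def)
    qed
  qed
  show ?thesis
  proof (cases n rule: int_cases2)
    case (nonneg m)
    then show ?thesis using \<open>\<And>n. poly_fn G p q d (twist (?T (int n)) f)\<close> by simp
  next
    case (nonpos m)
    from poly_fn_scale[OF poly_fn_hom[OF T(1)[of "- int m"] nonneg[of m]], of "-1"] show ?thesis
    proof (rule poly_fn_cong[rotated])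
      fix u assume "u \<in> carrier G"
      then show "-1 * twist (?T (int m)) f (?T (- int m) u) = twist (?T n) f u"
        using T(4)[of u "int m" "- int m"] T(2) by (simp add: twist_def nonpos)
    qed
  qed
qed

text \<open>Each degree on \<open>G\<close> is refined into \<open>k\<close> steps, according to the power of $\varphi - 1$ that lowers
  the degree.\<close>

lemma poly_fn_semidirect_int:
  assumes \<phi>: "\<phi> \<in> auto G"
    and lower: "\<And>d f. poly_fn G p q (Suc d) f \<Longrightarrow> poly_fn G p q d ((twist \<phi> ^^ k) f)"
    and "poly_fn G p q d f"
  shows "poly_fn (semidirect_int G \<phi>) 0 q (k * d) (\<lambda>x. f (snd x))"
  using assms(3)
proof (induction d arbitrary: f)
  case 0
  then show ?case by (auto simp: semidirect_int_def)
next
  case (Suc d)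
  let ?S = "semidirect_int G \<phi>"
  let ?T = "\<lambda>n::int. \<phi> [^]\<^bsub>AutoGroup G\<^esub> n"
  note T = auto_int_pow[OF \<phi>]
  interpret S: group ?S by (rule group_semidirect_int[OF \<phi>])
  have \<phi>h: "\<phi> \<in> hom G G" using T(1)[of 1] T(3) by simp
  have Tc: "?T n u \<in> carrier G" if "u \<in> carrier G" for n u
    using T(1)[of n] that by (auto simp: hom_def)
  \<comment> \<open>Interpolates between degrees d and d + 1: j = 0 is the outer induction
    hypothesis, and j = k is the goal by \<open>lower\<close>.\<close>
  have "poly_fn ?S 0 q (k * d + j) (\<lambda>x. f (snd x))"
    if "poly_fn G p q (Suc d) f" "poly_fn G p q d ((twist \<phi> ^^ j) f)" for j f
    using that
  proof (induction j arbitrary: f)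
    case 0
    then show ?case using Suc.IH by simp
  next
    case (Suc j)
    have "poly_fn ?S 0 q (k * d + j) (right_diff ?S g (\<lambda>x. f (snd x)))" if gS: "g \<in> carrier ?S" for g
    proof -
      obtain n v where g: "g = (n, v)" and v: "v \<in> carrier G"
        using gS by (auto simp: semidirect_int_def)
      \<comment> \<open>From (m, u)(n, v) = (m + n, \<phi>^n(u) v), the difference along g is (D_v
        f)(\<phi>^n u) + (f(\<phi>^n u) - f(u)). The first summand has degree d already; the second
        needs one power of \<phi> - 1 less than f.\<close>
      define f1 where "f1 = (\<lambda>u. right_diff G v f (?T n u))"
      define h where "h = (\<lambda>u. f1 u + twist (?T n) f u)"
      have f1: "poly_fn G p q d f1"
        unfolding f1_def using Suc.prems v by (intro poly_fn_hom[OF T(1)]) simp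
      have "poly_fn G p q (Suc d) h"
        unfolding h_def twist_def
        using poly_fn_Suc[OF f1] Suc.prems(1)
        by (intro poly_fn_add poly_fn_diff poly_fn_hom[OF T(1)])
      moreover have "poly_fn G p q d ((twist \<phi> ^^ j) h)"
      proof -
        \<comment> \<open>\<phi>^n - 1 commutes with the powers of \<phi> - 1, so it may be applied
          last.\<close>
        have "poly_fn G p q d (twist (?T n) ((twist \<phi> ^^ j) f))"
          using Suc.prems(2) by (intro poly_fn_int_pow_twist[OF \<phi>]) simp
        then have "poly_fn G p q d ((twist \<phi> ^^ j) (twist (?T n) f))"
        proof (rule poly_fn_cong[rotated])
          fix u assume "u \<in> carrier G"
          then have "(twist \<phi> ^^ j) (\<lambda>u. f (?T n u)) u = (twist \<phi> ^^ j) f (?T n u)"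
          proof (induction j arbitrary: u)
            case (Suc j)
            have "?T n (\<phi> u) = \<phi> (?T n u)"
              using T(4)[of u 1 n] T(4)[of u n 1] T(3) Suc.prems by (simp add: add.commute)
            moreover have "\<phi> u \<in> carrier G" using \<phi>h Suc.prems by (auto simp: hom_def)
            ultimately show ?case using Suc by (simp add: twist_def)
          qed simp
          then show "twist (?T n) ((twist \<phi> ^^ j) f) u = (twist \<phi> ^^ j) (twist (?T n) f) u"
            unfolding twist_def[of "?T n", abs_def] by (simp add: funpow_twist_diff)
        qed
        then show ?thesis
          unfolding h_def funpow_twist_add
          by (intro poly_fn_add poly_fn_funpow_twist[OF \<phi>h f1])
      qed
      ultimately have "poly_fn ?S 0 q (k * d + j) (\<lambda>x. h (snd x))"
        by (rule Suc.IH)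
      then show ?thesis
      proof (rule S.poly_fn_cong[rotated])
        fix x assume "x \<in> carrier ?S"
        then show "h (snd x) = right_diff ?S g (\<lambda>x. f (snd x)) x"
          by (auto simp: semidirect_int_def h_def f1_def right_diff_def twist_def g)
      qed
    qed
    then show ?case by (simp add: poly_fn_zero)
  qed
  from this[OF Suc.prems lower[OF Suc.prems]] show ?case by (simp add: add.commute)
qed

text \<open>All terms but the outer two of $\varphi^p = (1 + (\varphi - 1))^p$ are divisible by $p$.\<close>

lemma twist_prime_pow_lower:
  assumes p: "prime p" and \<phi>: "\<phi> \<in> hom G G"
    and "poly_fn G (int p) q (Suc d) f" "poly_fn G (int p) q d (twist (\<phi> ^^ p) f)"
  shows "poly_fn G (int p) q d ((twist \<phi> ^^ p) f)"
proof -
  have p1: "p > 1" using p by (rule prime_gt_1_nat)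
  let ?B = "\<lambda>k. (twist \<phi> ^^ k) f"
  \<comment> \<open>The middle binomial terms: powers of \<phi> - 1 keep degree d + 1, and the
    factor p lowers it to d.\<close>
  have "poly_fn G (int p) q d (\<lambda>u. int p * (\<Sum>k\<in>{1..<p}. int ((p choose k) div p) * ?B k u))"
    unfolding sum_distrib_left
  proof (rule poly_fn_sum)
    fix k
    have "poly_fn G (int p) q (Suc d) (?B k)"
      by (rule poly_fn_funpow_twist[OF \<phi> assms(3)])
    then have "poly_fn G (int p) q d (\<lambda>u. int p * ?B k u)" by simp
    from poly_fn_scale[OF this, of "int ((p choose k) div p)"]
    show "poly_fn G (int p) q d (\<lambda>u. int p * (int ((p choose k) div p) * ?B k u))"
      by (simp add: mult.left_commute)
  qed
  from poly_fn_diff[OF assms(4) this] show ?thesis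
  proof (rule poly_fn_cong[rotated])
    fix u
    have "{..p} = insert 0 (insert p {1..<p})" using p1 by auto
    then have "f ((\<phi> ^^ p) u) = f u + (?B p u + (\<Sum>k\<in>{1..<p}. int (p choose k) * ?B k u))"
      unfolding funpow_eq_sum_twist using p1 by simp
    also have "(\<Sum>k\<in>{1..<p}. int (p choose k) * ?B k u) =
        (\<Sum>k\<in>{1..<p}. int p * (int ((p choose k) div p) * ?B k u))"
    proof (rule sum.cong[OF refl])
      fix k assume "k \<in> {1..<p}"
      then have "p dvd p choose k" using p by (intro dvd_choose_prime) auto
      then have "p choose k = p * ((p choose k) div p)" by simp
      then have "int (p choose k) = int p * int ((p choose k) div p)"
        by (metis of_nat_mult)
      then show "int (p choose k) * ?B k u = int p * (int ((p choose k) div p) * ?B k u)"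
        by simp
    qed
    finally show "twist (\<phi> ^^ p) f u -
        int p * (\<Sum>k\<in>{1..<p}. int ((p choose k) div p) * ?B k u) = ?B p u"
      by (simp add: twist_def[of "\<phi> ^^ p"] sum_distrib_left)
  qed
qed

end

section \<open>Automorphisms acting trivially on the abelianization modulo a prime\<close>

lemma exponent_sum_one: "exponent_sum i \<one>\<^bsub>free_group\<^esub> = 0"
  and exponent_sum_mult: "\<lbrakk>u \<in> carrier free_group; v \<in> carrier free_group\<rbrakk> \<Longrightarrow>
    exponent_sum i (u \<otimes>\<^bsub>free_group\<^esub> v) = exponent_sum i u + exponent_sum i v"
  and exponent_sum_inv: "u \<in> carrier free_group \<Longrightarrow>
    exponent_sum i (inv\<^bsub>free_group\<^esub> u) = - exponent_sum i u"
proof -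
  interpret e: group_hom free_group integer_group "exponent_sum i"
    by (rule group_hom_exponent_sum)
  show "exponent_sum i \<one>\<^bsub>free_group\<^esub> = 0" using e.hom_one by simp
  show "\<lbrakk>u \<in> carrier free_group; v \<in> carrier free_group\<rbrakk> \<Longrightarrow>
    exponent_sum i (u \<otimes>\<^bsub>free_group\<^esub> v) = exponent_sum i u + exponent_sum i v"
    using e.hom_mult by simp
  show "u \<in> carrier free_group \<Longrightarrow> exponent_sum i (inv\<^bsub>free_group\<^esub> u) = - exponent_sum i u"
    using e.hom_inv by simp
qed

lemma sum_exponent_sum_free_gen:
  fixes g :: "'a::finite \<Rightarrow> int"
  shows "(\<Sum>i\<in>UNIV. exponent_sum i (free_gen a) * g i) = g a"
proof -
  have "(\<Sum>i\<in>UNIV. exponent_sum i (free_gen a) * g i) = (\<Sum>i\<in>UNIV. if a = i then g i else 0)"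
    by (rule sum.cong) (auto simp: exponent_sum_free_gen)
  then show ?thesis by simp
qed

text \<open>By \<open>right_diff_mult\<close>, w - 1 is additive in w up to two degrees, so it is
  determined by its values on the generators, weighted by exponent sums.\<close>

lemma right_diff_free_group:
  fixes w :: "('a::finite \<times> bool) list"
  assumes f: "poly_fn free_group p q (Suc (Suc d)) f" and "w \<in> carrier free_group"
  shows "poly_fn free_group p q d (\<lambda>u. right_diff free_group w f u -
      (\<Sum>i\<in>UNIV. exponent_sum i w * right_diff free_group (free_gen i) f u))"
  using assms(2)
proof (induction rule: free_group_induct)
  interpret F: group "free_group :: ('a \<times> bool) list monoid" by (rule group_free_group)
  let ?D = "\<lambda>v. right_diff (free_group :: ('a \<times> bool) list monoid) v f"
  let ?L = "\<lambda>w u. \<Sum>i\<in>UNIV. exponent_sum i w * ?D (free_gen i) u"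
  {
    case one
    show ?case
      by (rule F.poly_fn_cong[OF _ poly_fn_zero]) (simp add: right_diff_def exponent_sum_one)
  next
    case (mult_gen a w)
    have "?L (free_gen a \<otimes>\<^bsub>free_group\<^esub> w) u = ?D (free_gen a) u + ?L w u" for u
      using mult_gen(1)
      by (simp add: exponent_sum_mult ring_distribs sum.distrib sum_exponent_sum_free_gen)
    with poly_fn_add[OF F.right_diff_mult[OF f free_gen_closed[of a] mult_gen(1)] mult_gen(2)]
    show ?case by (simp add: algebra_simps)
  next
    case (mult_inv_gen a w)
    have ic: "inv\<^bsub>free_group\<^esub> free_gen a \<in> carrier free_group" by simp
    have L: "?L (inv\<^bsub>free_group\<^esub> free_gen a \<otimes>\<^bsub>free_group\<^esub> w) u = ?L w u - ?D (free_gen a) u" for u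
      using mult_inv_gen(1)
      by (simp add: exponent_sum_mult exponent_sum_inv left_diff_distrib sum_subtractf
          sum_exponent_sum_free_gen)
    \<comment> \<open>Additivity applied to a^-1 a = 1 shows that D_{a^-1} equals -D_a up to degree
      d.\<close>
    from poly_fn_diff[OF poly_fn_add[OF F.right_diff_mult[OF f ic mult_inv_gen(1)] mult_inv_gen(2)]
        F.right_diff_mult[OF f ic free_gen_closed[of a]]]
    show ?case
    proof (rule F.poly_fn_cong[rotated])
      fix u :: "('a \<times> bool) list" assume u: "u \<in> carrier free_group"
      have "?D (inv\<^bsub>free_group\<^esub> free_gen a \<otimes>\<^bsub>free_group\<^esub> free_gen a) u = 0"
        using u by (simp add: right_diff_def)
      then show "?D (inv\<^bsub>free_group\<^esub> free_gen a \<otimes>\<^bsub>free_group\<^esub> w) u -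
           (?D (inv\<^bsub>free_group\<^esub> free_gen a) u + ?D w u) + (?D w u - ?L w u) -
           (?D (inv\<^bsub>free_group\<^esub> free_gen a \<otimes>\<^bsub>free_group\<^esub> free_gen a) u -
            (?D (inv\<^bsub>free_group\<^esub> free_gen a) u + ?D (free_gen a) u)) =
           ?D (inv\<^bsub>free_group\<^esub> free_gen a \<otimes>\<^bsub>free_group\<^esub> w) u -
           ?L (inv\<^bsub>free_group\<^esub> free_gen a \<otimes>\<^bsub>free_group\<^esub> w) u"
        unfolding L by linarith
    qed
  }
qed

text \<open>Induction through D_v (\<psi> - 1) f = (\<psi> - 1) D_{\<psi> v} f + (D_{\<psi> v} f -
  D_v f). Up to degree d the bracket is a combination of the D_{x_i} f with coefficients divisible
  by p, and p lowers their degree.\<close>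

lemma twist_lower:
  assumes \<psi>: "\<psi> \<in> hom F2 F2"
    and triv: "\<And>i v. v \<in> carrier F2 \<Longrightarrow> p dvd exponent_sum i (\<psi> v) - exponent_sum i v"
    and "poly_fn F2 p q (Suc d) f"
  shows "poly_fn F2 p q d (twist \<psi> f)"
  using assms(3)
proof (induction d arbitrary: f)
  interpret F: group F2 by (rule group_free_group)
  have \<psi>c: "\<psi> u \<in> carrier F2" if "u \<in> carrier F2" for u
    using \<psi> that by (auto simp: hom_def)
  {
    case 0
    show ?case
      unfolding poly_fn.simps
    proof
      fix u assume u: "u \<in> carrier F2"
      \<comment> \<open>At a fixed u the twist is a right difference, along an element depending on
        u; this suffices since degree 0 is a pointwise condition.\<close>
      let ?v = "inv\<^bsub>F2\<^esub> u \<otimes>\<^bsub>F2\<^esub> \<psi> u"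
      have "q dvd right_diff F2 ?v f u" using 0 u \<psi>c by simp
      moreover have "u \<otimes>\<^bsub>F2\<^esub> ?v = \<psi> u" using u \<psi>c by (simp flip: F.m_assoc)
      ultimately show "q dvd twist \<psi> f u" by (simp add: right_diff_def twist_def)
    qed
  next
    case (Suc d)
    have "poly_fn F2 p q d (\<lambda>u. p * twist \<psi> f u)"
    proof -
      have "(\<lambda>u. p * twist \<psi> f u) = twist \<psi> (\<lambda>u. p * f u)"
        by (auto simp: twist_def ring_distribs)
      then show ?thesis using Suc.IH[of "\<lambda>u. p * f u"] Suc.prems by simp
    qed
    moreover have "poly_fn F2 p q d (right_diff F2 v (twist \<psi> f))" if v: "v \<in> carrier F2" for v
    proof -
      let ?D = "\<lambda>v. right_diff F2 v f"
      have "poly_fn F2 p q d (twist \<psi> (?D (\<psi> v)))"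
        using Suc.prems \<psi>c[OF v] by (intro Suc.IH) simp
      moreover
      let ?L = "\<lambda>w u. \<Sum>i\<in>UNIV. exponent_sum i w * ?D (free_gen i) u"
      obtain c where c: "exponent_sum i (\<psi> v) - exponent_sum i v = p * c i" for i
        using triv[OF v] unfolding dvd_def by metis
      have "poly_fn F2 p q d (\<lambda>u. \<Sum>i\<in>UNIV. c i * (p * ?D (free_gen i) u))"
      proof (rule poly_fn_sum, rule poly_fn_scale)
        fix i :: 2
        have "poly_fn F2 p q (Suc d) (?D (free_gen i))" using Suc.prems by simp
        then show "poly_fn F2 p q d (\<lambda>u. p * ?D (free_gen i) u)" by simp
      qed
      moreover have "(\<Sum>i\<in>UNIV. c i * (p * ?D (free_gen i) u)) = ?L (\<psi> v) u - ?L v u" for u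
        unfolding sum_subtractf[symmetric] left_diff_distrib[symmetric] c
        by (simp add: mult_ac)
      ultimately have "poly_fn F2 p q d (\<lambda>u. twist \<psi> (?D (\<psi> v)) u +
          (((?D (\<psi> v) u - ?L (\<psi> v) u) - (?D v u - ?L v u)) + (?L (\<psi> v) u - ?L v u)))"
        using right_diff_free_group[OF Suc.prems \<psi>c[OF v]] right_diff_free_group[OF Suc.prems v]
        by (intro poly_fn_add[of F2 p q d "twist \<psi> (?D (\<psi> v))"]
            poly_fn_add[OF poly_fn_diff, of F2 p q d]) simp_all
      then show ?thesis
      proof (rule F.poly_fn_cong[rotated])
        fix u assume "u \<in> carrier F2"
        then have "\<psi> (u \<otimes>\<^bsub>F2\<^esub> v) = \<psi> u \<otimes>\<^bsub>F2\<^esub> \<psi> v" using \<psi> v by (auto simp: hom_def)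
        then show "twist \<psi> (?D (\<psi> v)) u +
          (((?D (\<psi> v) u - ?L (\<psi> v) u) - (?D v u - ?L v u)) + (?L (\<psi> v) u - ?L v u)) =
          right_diff F2 v (twist \<psi> f) u"
          by (simp add: right_diff_def twist_def)
      qed
    qed
    ultimately show ?case by simp
  }
qed

section \<open>Powers of the induced matrix\<close>

lemma exponent_sum_auto:
  assumes "\<phi> \<in> auto F2" "w \<in> carrier F2"
  shows "exponent_sum i (\<phi> w) = (\<Sum>j\<in>UNIV. ab_matrix \<phi> $ i $ j * exponent_sum j w)"
  using assms(2)
proof (induction rule: free_group_induct)
  interpret \<phi>: group_hom F2 F2 \<phi>
    using assms(1) by (intro group_hom.intro group_hom_axioms.intro group_free_group) (simp add: auto_def)
  have gen: "exponent_sum i (\<phi> (free_gen a)) =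
      (\<Sum>j\<in>UNIV. ab_matrix \<phi> $ i $ j * exponent_sum j (free_gen a))" for a
    unfolding represents_ab_ab_matrix(3)[OF assms(1), symmetric]
    using sum_exponent_sum_free_gen[of a "\<lambda>j. ab_matrix \<phi> $ i $ j"] by (simp add: mult.commute)
  {
    case one
    show ?case by (simp add: exponent_sum_one)
  next
    case (mult_gen a w)
    then show ?case
      by (simp add: exponent_sum_mult gen ring_distribs sum.distrib)
  next
    case (mult_inv_gen a w)
    then show ?case
      by (simp add: exponent_sum_mult exponent_sum_inv gen right_diff_distrib sum_subtractf)
  }
qed

text \<open>Cayley-Hamilton for the matrix with rows (a, b) and (c, d) of determinant 1, applied to
  the vector (x, y).\<close>

lemma matrix_2_square:
  fixes a b c d x y :: int
  assumes "a * d = 1 + b * c"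
  shows "a * (a * x + b * y) + b * (c * x + d * y) = (a + d) * (a * x + b * y) - x"
    and "c * (a * x + b * y) + d * (c * x + d * y) = (a + d) * (c * x + d * y) - y"
proof -
  have "(a * d) * x = (1 + b * c) * x" "(a * d) * y = (1 + b * c) * y"
    by (simp_all only: assms)
  then show "a * (a * x + b * y) + b * (c * x + d * y) = (a + d) * (a * x + b * y) - x"
    "c * (a * x + b * y) + d * (c * x + d * y) = (a + d) * (c * x + d * y) - y"
    by (simp_all add: algebra_simps)
qed

text \<open>By Cayley-Hamilton the exponent sums satisfy e(n+2) = tr e(n+1) - e(n). As tr = 2 modulo
  p, they form an arithmetic progression modulo p. It will be used with n = p.\<close>

lemma exponent_sum_auto_funpow:
  assumes \<phi>: "\<phi> \<in> auto F2" and det: "det (ab_matrix \<phi>) = 1"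
    and p: "p dvd 2 - trace (ab_matrix \<phi>)" and w: "w \<in> carrier F2"
  shows "p dvd exponent_sum i ((\<phi> ^^ n) w) -
    (exponent_sum i w + int n * (exponent_sum i (\<phi> w) - exponent_sum i w))"
proof -
  let ?e = "\<lambda>n. exponent_sum i ((\<phi> ^^ n) w)"
  let ?M = "ab_matrix \<phi>"
  have \<phi>c: "\<phi> u \<in> carrier F2" if "u \<in> carrier F2" for u
    using \<phi> that by (auto simp: auto_def hom_def)
  have c: "(\<phi> ^^ n) w \<in> carrier F2" for n
    by (induction n) (simp_all add: w \<phi>c)
  have rec: "?e (Suc (Suc n)) = trace ?M * ?e (Suc n) - ?e n" for n
  proof -
    let ?E = "\<lambda>j. exponent_sum j ((\<phi> ^^ n) w)"
    have 1: "?M $ 1 $ 1 * ?M $ 2 $ 2 = 1 + ?M $ 1 $ 2 * ?M $ 2 $ 1"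
      using det by (simp add: det_2)
    have 2: "exponent_sum j (\<phi> u) = ?M $ j $ 1 * exponent_sum 1 u + ?M $ j $ 2 * exponent_sum 2 u"
      if "u \<in> carrier F2" for u j
      using exponent_sum_auto[OF \<phi> that] by (simp add: sum_2)
    have 3: "?e (Suc (Suc n)) = ?M $ i $ 1 * (?M $ 1 $ 1 * ?E 1 + ?M $ 1 $ 2 * ?E 2)
        + ?M $ i $ 2 * (?M $ 2 $ 1 * ?E 1 + ?M $ 2 $ 2 * ?E 2)"
      using 2[OF \<phi>c[OF c]] 2[OF c] by simp
    have "i = 1 \<or> i = 2" by (rule exhaust_2)
    then show ?thesis
    proof
      assume i: "i = 1"
      show ?thesis
        using matrix_2_square(1)[OF 1, of "?E 1" "?E 2"] 3 2[OF c] by (simp add: trace_def sum_2 i)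
    next
      assume i: "i = 2"
      show ?thesis
        using matrix_2_square(2)[OF 1, of "?E 1" "?E 2"] 3 2[OF c] by (simp add: trace_def sum_2 i)
    qed
  qed
  \<comment> \<open>The recurrence has order two, so two consecutive terms are carried
    along.\<close>
  have "p dvd ?e n - (?e 0 + int n * (?e 1 - ?e 0)) \<and>
      p dvd ?e (Suc n) - (?e 0 + int (Suc n) * (?e 1 - ?e 0))"
  proof (induction n)
    case (Suc n)
    have "?e (Suc (Suc n)) - (?e 0 + int (Suc (Suc n)) * (?e 1 - ?e 0)) =
      2 * (?e (Suc n) - (?e 0 + int (Suc n) * (?e 1 - ?e 0))) - (?e n - (?e 0 + int n * (?e 1 - ?e 0)))
       - (2 - trace ?M) * ?e (Suc n)"
      unfolding rec of_nat_Suc by algebra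
    also have "p dvd \<dots>"
      by (rule dvd_diff[OF dvd_diff[OF dvd_mult[OF conjunct2[OF Suc]] conjunct1[OF Suc]]
            dvd_mult2[OF p]])
    finally show ?case using Suc by blast
  qed simp
  then show ?thesis by simp
qed

section \<open>A faithful action of the free group\<close>

text \<open>The generators act by the two elementary unipotent matrices with off-diagonal entry \<open>s\<close>,
  which generate a free group by ping-pong for \<open>s \<ge> 3\<close>; being trivial modulo \<open>s\<close>, they make the
  matrix entries polynomial functions.\<close>

fun pp_step :: "int \<Rightarrow> 2 \<times> bool \<Rightarrow> int \<times> int \<Rightarrow> int \<times> int" where
  "pp_step s (i, e) (a, b) =
     (if i = 1 then (a + (if e then s else - s) * b, b) else (a, b + (if e then s else - s) * a))"

definition pp_act :: "int \<Rightarrow> (2 \<times> bool) list \<Rightarrow> int \<times> int \<Rightarrow> int \<times> int" where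
  "pp_act s w z = foldr (pp_step s) w z"

text \<open>Inverse letters act by inverse matrices, so free reduction does not change the
  action.\<close>

lemma pp_act_mult: "pp_act s (u \<otimes>\<^bsub>F2\<^esub> v) z = pp_act s u (pp_act s v z)"
proof -
  have cancel: "pp_step s l (pp_step s (inv_letter l) z) = z" for l z
    by (cases l; cases z) (simp add: inv_letter_def)
  have push: "pp_act s (push_letter l w) z = pp_step s l (pp_act s w z)" for l w
    by (cases "(l, w)" rule: push_letter.cases) (simp_all add: pp_act_def cancel)
  show ?thesis
    unfolding mult_free_group by (induction u) (simp_all add: push, simp_all add: pp_act_def)
qed

lemma pp_act_linear:
  "pp_act s w (a + c * a', b + c * b') =
     (fst (pp_act s w (a, b)) + c * fst (pp_act s w (a', b')),
      snd (pp_act s w (a, b)) + c * snd (pp_act s w (a', b')))"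
proof (induction w)
  case (Cons l w)
  obtain x y where 1: "pp_act s w (a, b) = (x, y)" by force
  obtain x' y' where 2: "pp_act s w (a', b') = (x', y')" by force
  show ?case
    using Cons 1 2 by (cases l) (auto simp: pp_act_def algebra_simps)
qed (simp add: pp_act_def)

lemma pp_act_cong: "\<exists>a' b'. pp_act s w (a, b) = (a + s * a', b + s * b')"
proof (induction w)
  case Nil
  show ?case by (rule exI[of _ 0], rule exI[of _ 0]) (simp add: pp_act_def)
next
  case (Cons l w)
  then obtain a' b' where w: "pp_act s w (a, b) = (a + s * a', b + s * b')" by blast
  obtain i e where l: "l = (i, e)" by force
  show ?case
  proof (cases "i = 1")
    case True
    with w show ?thesis
      by (intro exI[of _ "a' + (if e then 1 else -1) * (b + s * b')"] exI[of _ b'])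
        (simp add: pp_act_def l algebra_simps)
  next
    case False
    with w show ?thesis
      by (intro exI[of _ a'] exI[of _ "b' + (if e then 1 else -1) * (a + s * a')"])
        (simp add: pp_act_def l algebra_simps)
  qed
qed

text \<open>For L_z(u) = fst(uz) - snd(uz), the vector vz - z is s z' by \<open>pp_act_cong\<close>,
  hence D_v L_z = s L_{z'}. Each difference thus gains a factor p, and k such factors give zero
  modulo p^k. The vector z and the exponent i vary in the induction.\<close>

lemma poly_fn_pp_act:
  assumes "k \<le> i + j" "p dvd s"
  shows "poly_fn F2 p (p ^ k) j (\<lambda>u. p ^ i * (fst (pp_act s u z) - snd (pp_act s u z)))"
  using assms(1)
proof (induction j arbitrary: i z)
  case 0
  then show ?case by (simp add: le_imp_power_dvd)
next
  case (Suc j)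
  let ?L = "\<lambda>z u. fst (pp_act s u z) - snd (pp_act s u z)"
  have IH: "poly_fn F2 p (p ^ k) j (\<lambda>u. p ^ Suc i * ?L z u)" for z
    using Suc.prems by (intro Suc.IH) simp
  have "poly_fn F2 p (p ^ k) j (right_diff F2 v (\<lambda>u. p ^ i * ?L z u))" for v
  proof -
    obtain a b where z: "z = (a, b)" by force
    obtain a' b' where v: "pp_act s v (a, b) = (a + s * a', b + s * b')"
      using pp_act_cong by blast
    obtain c where c: "s = p * c" using assms(2) by blast
    have "right_diff F2 v (\<lambda>u. p ^ i * ?L z u) = (\<lambda>u. s * (p ^ i * ?L (a', b') u))"
      by (rule ext) (simp add: right_diff_def pp_act_mult z v pp_act_linear, simp add: algebra_simps)
    also have "\<dots> = (\<lambda>u. c * (p ^ Suc i * ?L (a', b') u))"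
      by (simp only: c power_Suc mult_ac)
    finally have "right_diff F2 v (\<lambda>u. p ^ i * ?L z u) = (\<lambda>u. c * (p ^ Suc i * ?L (a', b') u))" .
    then show ?thesis using poly_fn_scale[OF IH] by simp
  qed
  moreover have "poly_fn F2 p (p ^ k) j (\<lambda>u. p * (p ^ i * ?L z u))"
    using IH[of z] by (simp add: mult.assoc)
  ultimately show ?case by simp
qed

section \<open>Ping-pong\<close>

text \<open>The attracting sectors of the four letters, pairwise disjoint. On each of them the
  coordinates are nonzero and distinct, so fst - snd does not vanish.\<close>

definition pp_region :: "2 \<times> bool \<Rightarrow> (int \<times> int) set" where
  "pp_region l = {(a, b). (if fst l = 1 then \<bar>b\<bar> < \<bar>a\<bar> else \<bar>a\<bar> < \<bar>b\<bar>) \<and>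
      (if snd l then 0 < a * b else a * b < 0)}"

text \<open>The case |a| = |b| admits the start vector (1, 1); there s = 2 would fail, as a = -b
  gives |a + 2b| = |b|.\<close>

lemma pp_step_expand:
  fixes a b s :: int
  assumes "3 \<le> s" "b \<noteq> 0" "\<bar>a\<bar> < \<bar>b\<bar> \<or> 0 < a * b \<or> \<bar>a\<bar> = \<bar>b\<bar>"
  shows "\<bar>b\<bar> < \<bar>a + s * b\<bar>" "0 < (a + s * b) * b"
proof -
  have "\<bar>b\<bar> < \<bar>a + s * b\<bar> \<and> 0 < (a + s * b) * b"
  proof (cases "b > 0")
    case True
    then have "3 * b \<le> s * b" using assms(1) by simp
    moreover have "- b \<le> a" using assms(3) True by (auto simp: zero_less_mult_iff)
    ultimately have "b < a + s * b" using True by linarith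
    then show ?thesis using True by simp
  next
    case False
    then have "b < 0" using assms(2) by simp
    then have "s * b \<le> 3 * b" using assms(1) by simp
    moreover have "a \<le> - b" using assms(3) \<open>b < 0\<close> by (auto simp: zero_less_mult_iff)
    ultimately have "a + s * b < b" using \<open>b < 0\<close> by linarith
    then show ?thesis using \<open>b < 0\<close> by (simp add: mult_neg_neg)
  qed
  then show "\<bar>b\<bar> < \<bar>a + s * b\<bar>" "0 < (a + s * b) * b" by auto
qed

lemma pp_step_expand_minus:
  fixes a b s :: int
  assumes "3 \<le> s" "b \<noteq> 0" "\<bar>a\<bar> < \<bar>b\<bar> \<or> a * b < 0 \<or> \<bar>a\<bar> = \<bar>b\<bar>"
  shows "\<bar>b\<bar> < \<bar>a - s * b\<bar>" "(a - s * b) * b < 0"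
proof -
  have "\<bar>b\<bar> < \<bar>- a + s * b\<bar>" "0 < (- a + s * b) * b"
    using pp_step_expand[of s b "- a"] assms by auto
  moreover have "- a + s * b = - (a - s * b)" by simp
  ultimately show "\<bar>b\<bar> < \<bar>a - s * b\<bar>" "(a - s * b) * b < 0"
    by (metis abs_minus_cancel, metis minus_mult_left neg_0_less_iff_less)
qed

lemma pp_act_region:
  assumes "3 \<le> s" "reduced (l # w)"
  shows "pp_act s (l # w) (1, 1) \<in> pp_region l"
  using assms(2)
proof (induction w arbitrary: l)
  \<comment> \<open>The assumptions say that (a, b) has nonzero coordinates and lies outside the
    sector of \<open>inv_letter l\<close>.\<close>
  have step: "pp_step s l (a, b) \<in> pp_region l"
    if "a \<noteq> 0" "b \<noteq> 0"
      and "\<bar>a\<bar> = \<bar>b\<bar> \<or> (if fst l = 1 then \<bar>a\<bar> < \<bar>b\<bar> else \<bar>b\<bar> < \<bar>a\<bar>) \<or> (if snd l then 0 < a * b else a * b < 0)"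
    for a b l
  proof -
    obtain i e where l: "l = (i, e)" by force
    show ?thesis
    proof (cases "i = 1")
      case True
      then show ?thesis
        using that pp_step_expand[OF assms(1), of b a] pp_step_expand_minus[OF assms(1), of b a]
        by (cases e) (simp_all add: l pp_region_def, blast+)
    next
      case False
      then show ?thesis
        using that pp_step_expand[OF assms(1), of a b] pp_step_expand_minus[OF assms(1), of a b]
        by (cases e) (simp_all add: l pp_region_def mult.commute[of _ b] mult.commute[of a], auto simp: mult.commute)
    qed
  qed
  {
    case Nil
    show ?case using step[of 1 1] by (simp add: pp_act_def)
  next
    case (Cons m w)
    have m: "m \<noteq> inv_letter l" "reduced (m # w)"
      using Cons.prems by (auto simp: reduced_Cons)
    obtain a b where ab: "pp_act s (m # w) (1, 1) = (a, b)" by force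
    with Cons.IH[OF m(2)] have "(a, b) \<in> pp_region m" by simp
    then have "a \<noteq> 0" "b \<noteq> 0" "(if fst l = 1 then \<bar>a\<bar> < \<bar>b\<bar> else \<bar>b\<bar> < \<bar>a\<bar>) \<or> (if snd l then 0 < a * b else a * b < 0)"
      using m(1) exhaust_2[of "fst l"] exhaust_2[of "fst m"]
      by (auto simp: pp_region_def inv_letter_def prod_eq_iff split: if_splits)
    from step[OF this(1,2)] this(3) have "pp_step s l (a, b) \<in> pp_region l" by blast
    then show ?case using ab by (simp add: pp_act_def)
  }
qed

lemma exists_prime_pow_poly_fn_F2:
  assumes p: "1 < p" and w: "w \<in> carrier F2" "w \<noteq> \<one>\<^bsub>F2\<^esub>"
  shows "\<exists>k d f. poly_fn F2 p (p ^ k) d f \<and> \<not> p ^ k dvd f w - f \<one>\<^bsub>F2\<^esub>"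
proof -
  \<comment> \<open>The entry 2p is divisible by p and is at least 4, also for p = 2, so ping-pong
    applies.\<close>
  define f where "f u = fst (pp_act (2 * p) u (1, 1)) - snd (pp_act (2 * p) u (1, 1))" for u
  obtain l v where lv: "w = l # v" using w(2) by (cases w) (auto simp: one_free_group)
  have "pp_act (2 * p) w (1, 1) \<in> pp_region l"
    unfolding lv using w(1) p by (intro pp_act_region) (auto simp: carrier_free_group lv)
  then have nz: "f w \<noteq> 0" by (auto simp: f_def pp_region_def split: if_splits)
  have 0: "f \<one>\<^bsub>F2\<^esub> = 0" by (simp add: f_def pp_act_def one_free_group)
  \<comment> \<open>Since k < 2^k, this choice makes p^k exceed |f(w)|, so p^k cannot divide the
    nonzero f(w).\<close>
  define k where "k = nat \<bar>f w\<bar>"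
  have "int k < int (2 ^ k)" by (simp only: of_nat_less_iff less_exp)
  also have "\<dots> = 2 ^ k" by simp
  also have "2 ^ k \<le> p ^ k" using p by (intro power_mono) auto
  finally have "\<bar>f w\<bar> < p ^ k" by (simp add: k_def)
  then have "\<not> p ^ k dvd f w" using nz zdvd_imp_le[of "p ^ k" "\<bar>f w\<bar>"] by auto
  moreover have "poly_fn F2 p (p ^ k) k f"
    using poly_fn_pp_act[of k 0 k p "2 * p" "(1, 1)"] by (simp add: f_def[abs_def])
  ultimately show ?thesis
    using 0 by (intro exI[of _ k] exI[of _ f]) simp
qed

section \<open>Residual nilpotence of the semidirect product\<close>

lemma residually_nilpotent_semidirect:
  assumes \<phi>: "\<phi> \<in> auto F2" and det: "det (ab_matrix \<phi>) = 1"
    and p: "prime p" "int p dvd 2 - trace (ab_matrix \<phi>)"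
  shows "residually_nilpotent (semidirect_int F2 \<phi>)"
proof -
  let ?S = "semidirect_int F2 \<phi>"
  interpret F: group F2 by (rule group_free_group)
  interpret S: group ?S by (rule F.group_semidirect_int[OF \<phi>])
  have \<phi>h: "\<phi> \<in> hom F2 F2" using \<phi> by (simp add: auto_def)
  have \<phi>n: "\<phi> ^^ n \<in> hom F2 F2" for n
    by (induction n) (use \<phi>h in \<open>auto simp: hom_def Pi_iff\<close>)
  have lower: "poly_fn F2 (int p) q d ((twist \<phi> ^^ p) f)"
    if "poly_fn F2 (int p) q (Suc d) f" for q d f
  proof (rule F.twist_prime_pow_lower[OF p(1) \<phi>h that])
    show "poly_fn F2 (int p) q d (twist (\<phi> ^^ p) f)"
    proof (rule twist_lower[OF \<phi>n _ that])
      fix i v assume v: "v \<in> carrier F2"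
      have "exponent_sum i ((\<phi> ^^ p) v) - exponent_sum i v =
        exponent_sum i ((\<phi> ^^ p) v) - (exponent_sum i v + int p * (exponent_sum i (\<phi> v) - exponent_sum i v))
          + int p * (exponent_sum i (\<phi> v) - exponent_sum i v)" by simp
      also have "int p dvd \<dots>"
        by (intro dvd_add exponent_sum_auto_funpow[OF \<phi> det p(2) v] dvd_triv_left)
      finally show "int p dvd exponent_sum i ((\<phi> ^^ p) v) - exponent_sum i v" .
    qed
  qed
  show ?thesis
  proof (rule S.residually_nilpotentI)
    fix g assume g: "g \<in> carrier ?S" "g \<noteq> \<one>\<^bsub>?S\<^esub>"
    obtain m u where mu: "g = (m, u)" by force
    have u: "u \<in> carrier F2" using g(1) by (simp add: mu semidirect_int_def)
    show "\<exists>p' q n f. poly_fn ?S p' q n f \<and> \<not> q dvd f g - f \<one>\<^bsub>?S\<^esub>"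
    proof (cases "m = 0")
      case False
      \<comment> \<open>Elements outside the free group are detected by the projection to the
        integers, a homomorphism and so of degree 2 even for q = 0, where divisibility means
        vanishing.\<close>
      have "right_diff ?S h fst x = fst h" for h x
        by (cases h; cases x) (simp add: right_diff_def semidirect_int_def)
      then have "right_diff ?S h fst = (\<lambda>x. fst h)" for h by blast
      moreover have "right_diff ?S h (\<lambda>x. c) = (\<lambda>x. 0)" for h c
        by (auto simp: right_diff_def)
      ultimately have "poly_fn ?S 0 0 2 fst"
        by (simp add: numeral_2_eq_2)
      moreover have "\<not> 0 dvd fst g - fst \<one>\<^bsub>?S\<^esub>" using False by (simp add: mu semidirect_int_def)
      ultimately show ?thesis by blast
    next
      case True
      then have "u \<noteq> \<one>\<^bsub>F2\<^esub>" using g(2) by (simp add: mu semidirect_int_def)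
      moreover have "1 < int p" using prime_gt_1_nat[OF p(1)] by simp
      ultimately obtain k d f where f: "poly_fn F2 (int p) (int p ^ k) d f"
        "\<not> int p ^ k dvd f u - f \<one>\<^bsub>F2\<^esub>"
        using exists_prime_pow_poly_fn_F2[OF _ u] by blast
      have "poly_fn ?S 0 (int p ^ k) (p * d) (\<lambda>x. f (snd x))"
        by (rule F.poly_fn_semidirect_int[OF \<phi> lower f(1)])
      moreover have "f (snd g) - f (snd \<one>\<^bsub>?S\<^esub>) = f u - f \<one>\<^bsub>F2\<^esub>"
        by (simp add: mu semidirect_int_def)
      ultimately show ?thesis using f(2) by metis
    qed
  qed
qed

section \<open>Trace 1 or 3\<close>

text \<open>Each class is that of some x^a y^b, and the exponent sums recover a and b.\<close>

lemma ab_class_eqI: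
  assumes u: "u \<in> carrier F2" and v: "v \<in> carrier F2"
    and "\<And>i. exponent_sum i u = exponent_sum i v"
  shows "ab_class F2 u = ab_class F2 v"
proof -
  interpret c: group_hom F2 "abelianization F2" "ab_class F2"
    by (rule group_hom_ab_class[OF group_free_group])
  interpret e: group_hom F2 integer_group "exponent_sum i" for i by (rule group_hom_exponent_sum)
  let ?w = "\<lambda>a b. free_gen 1 [^]\<^bsub>F2\<^esub> (a::int) \<otimes>\<^bsub>F2\<^esub> free_gen 2 [^]\<^bsub>F2\<^esub> (b::int)"
  have "ab_class F2 x = ab_class F2 (?w (exponent_sum 1 x) (exponent_sum 2 x))"
    if x: "x \<in> carrier F2" for x
  proof -
    obtain a b where ab: "ab_class F2 x = ab_class F2 (?w a b)"
      using ab_class_coordinates[OF x] by (auto simp: c.hom_int_pow)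
    have "exponent_sum i x = exponent_sum i (?w a b)" for i
      by (rule exponent_sum_cong[OF ab x]) simp
    then have "exponent_sum 1 x = a" "exponent_sum 2 x = b"
      by (auto simp: e.hom_int_pow exponent_sum_free_gen)
    then show ?thesis using ab by simp
  qed
  then show ?thesis using assms by metis
qed

text \<open>If one term contains the free group, the next contains its derived subgroup and all v
  \<phi>(v)^-1. As 1 - \<phi> is invertible on the abelianization, these generate the free group
  again.\<close>

lemma free_group_subset_lower_central:
  assumes \<phi>: "\<phi> \<in> auto F2" and det: "det (ab_matrix \<phi>) = 1"
    and tr: "trace (ab_matrix \<phi>) \<in> {1, 3}" and "u \<in> carrier F2"
  shows "(0, u) \<in> lower_central (semidirect_int F2 \<phi>) n"
  using assms(4)
proof (induction n arbitrary: u)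
  case 0
  then show ?case by (simp add: semidirect_int_def)
next
  case (Suc n)
  let ?S = "semidirect_int F2 \<phi>"
  let ?M = "ab_matrix \<phi>"
  interpret F: group F2 by (rule group_free_group)
  interpret S: group ?S by (rule F.group_semidirect_int[OF \<phi>])
  let ?t = "(1, \<one>\<^bsub>F2\<^esub>) :: int \<times> (2 \<times> bool) list"
  have t: "?t \<in> carrier ?S" by (simp add: semidirect_int_def)
  interpret \<iota>: group_hom F2 ?S "\<lambda>u. (0, u)"
  proof (intro group_hom.intro group_hom_axioms.intro F.is_group S.is_group)
    show "(\<lambda>u. (0, u)) \<in> hom F2 ?S"
      using F.auto_int_pow(2)[OF \<phi>] by (auto simp: hom_def semidirect_int_def)
  qed
  interpret \<phi>: group_hom F2 F2 \<phi>
    using \<phi> by (intro group_hom.intro group_hom_axioms.intro group_free_group) (simp add: auto_def)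
  have comm: "a \<otimes>\<^bsub>?S\<^esub> b \<otimes>\<^bsub>?S\<^esub> inv\<^bsub>?S\<^esub> a \<otimes>\<^bsub>?S\<^esub> inv\<^bsub>?S\<^esub> b \<in> lower_central ?S (Suc n)"
    if "a \<in> lower_central ?S n" "b \<in> carrier ?S" for a b
    using that unfolding lower_central.simps by (intro generate.incl) auto
  interpret N: subgroup "lower_central ?S (Suc n)" ?S
    by (rule normal_imp_subgroup[OF S.lower_central_normal])
  define H where "H = {u \<in> carrier F2. (0, u) \<in> lower_central ?S (Suc n)}"
  have H: "subgroup H F2"
  proof (rule F.subgroupI)
    show "H \<subseteq> carrier F2" by (auto simp: H_def)
    have "\<one>\<^bsub>F2\<^esub> \<in> H" using N.one_closed by (simp add: H_def del: lower_central.simps)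
    then show "H \<noteq> {}" by blast
    show "inv\<^bsub>F2\<^esub> a \<in> H" if "a \<in> H" for a
      using that N.m_inv_closed[of "(0, a)"] by (simp add: H_def del: lower_central.simps)
    show "a \<otimes>\<^bsub>F2\<^esub> b \<in> H" if "a \<in> H" "b \<in> H" for a b
      using that N.m_closed[of "(0, a)" "(0, b)"] by (simp add: H_def del: lower_central.simps)
  qed
  have "a \<otimes>\<^bsub>F2\<^esub> b \<otimes>\<^bsub>F2\<^esub> inv\<^bsub>F2\<^esub> a \<otimes>\<^bsub>F2\<^esub> inv\<^bsub>F2\<^esub> b \<in> H"
    if ab: "a \<in> carrier F2" "b \<in> carrier F2" for a b
    using comm[OF Suc.IH[OF ab(1)] \<iota>.hom_closed[OF ab(2)]] ab
    by (simp add: H_def del: lower_central.simps)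
  then have D: "derived F2 (carrier F2) \<subseteq> H"
    unfolding derived_def by (intro F.generate_subgroup_incl[OF _ H]) auto
  have T: "v \<otimes>\<^bsub>F2\<^esub> inv\<^bsub>F2\<^esub> (\<phi> v) \<in> H" if v: "v \<in> carrier F2" for v
  proof -
    \<comment> \<open>The commutator of v with t^-1 is v (t^-1 v^-1 t) = v \<phi>(v^-1).\<close>
    have "(0, v) \<otimes>\<^bsub>?S\<^esub> inv\<^bsub>?S\<^esub> ?t \<otimes>\<^bsub>?S\<^esub> inv\<^bsub>?S\<^esub> (0, v) \<otimes>\<^bsub>?S\<^esub> inv\<^bsub>?S\<^esub> (inv\<^bsub>?S\<^esub> ?t) =
        (0, v) \<otimes>\<^bsub>?S\<^esub> (inv\<^bsub>?S\<^esub> ?t \<otimes>\<^bsub>?S\<^esub> (0, inv\<^bsub>F2\<^esub> v) \<otimes>\<^bsub>?S\<^esub> ?t)"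
      using S.m_assoc[OF \<iota>.hom_closed[OF v]] t
      by (simp only: \<iota>.hom_inv[OF v, symmetric] S.inv_inv S.m_closed S.inv_closed
          \<iota>.hom_closed F.inv_closed v)
    also have "\<dots> = (0, v \<otimes>\<^bsub>F2\<^esub> inv\<^bsub>F2\<^esub> (\<phi> v))"
      using F.semidirect_int_conj[OF \<phi>, of "inv\<^bsub>F2\<^esub> v"] v by simp
    finally show ?thesis
      using comm[OF Suc.IH[OF v] S.inv_closed[OF t]] v by (simp add: H_def del: lower_central.simps)
  qed
  \<comment> \<open>\<open>(a, b)\<close> is the solution of $(1 - \overline\varphi)(a, b) = (e_1, e_2)$ given by Cramer's rule, with determinant \<open>c\<close>\<close>
  define c where "c = 2 - trace ?M"
  \<comment> \<open>As c is 1 or -1, multiplying by c in \<open>a\<close> and \<open>b\<close>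
    divides by the determinant.\<close>
  have c: "c * c = 1" using tr by (auto simp: c_def)
  have d: "?M $ 1 $ 1 * ?M $ 2 $ 2 - ?M $ 1 $ 2 * ?M $ 2 $ 1 = 1" using det by (simp add: det_2)
  have c': "c = 2 - ?M $ 1 $ 1 - ?M $ 2 $ 2" by (simp add: c_def trace_def sum_2)
  let ?e1 = "exponent_sum 1 u" and ?e2 = "exponent_sum 2 u"
  define a where "a = c * ((1 - ?M $ 2 $ 2) * ?e1 + ?M $ 1 $ 2 * ?e2)"
  define b where "b = c * (?M $ 2 $ 1 * ?e1 + (1 - ?M $ 1 $ 1) * ?e2)"
  define v where "v = free_gen 1 [^]\<^bsub>F2\<^esub> a \<otimes>\<^bsub>F2\<^esub> free_gen 2 [^]\<^bsub>F2\<^esub> b"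
  have v: "v \<in> carrier F2" by (simp add: v_def)
  have e: "exponent_sum 1 v = a" "exponent_sum 2 v = b"
  proof -
    interpret e: group_hom F2 integer_group "exponent_sum i" for i by (rule group_hom_exponent_sum)
    show "exponent_sum 1 v = a" "exponent_sum 2 v = b"
      by (auto simp: v_def e.hom_int_pow exponent_sum_free_gen)
  qed
  let ?w = "v \<otimes>\<^bsub>F2\<^esub> inv\<^bsub>F2\<^esub> (\<phi> v)"
  have w: "?w \<in> carrier F2" using v by simp
  have ew: "exponent_sum i ?w = exponent_sum i v - (?M $ i $ 1 * a + ?M $ i $ 2 * b)" for i
    using v by (simp add: exponent_sum_mult exponent_sum_inv exponent_sum_auto[OF \<phi>] sum_2 e)
  have "exponent_sum 1 ?w = c * c * ?e1" "exponent_sum 2 ?w = c * c * ?e2"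
    unfolding ew e a_def b_def using d c' by algebra+
  then have "exponent_sum i u = exponent_sum i ?w" for i
    using exhaust_2[of i] c by auto
  then have "ab_class F2 u = ab_class F2 ?w" by (intro ab_class_eqI Suc.prems w)
  then have "u \<in> derived F2 (carrier F2) #>\<^bsub>F2\<^esub> ?w"
    using F.rcos_self[OF Suc.prems F.derived_is_subgroup[of "carrier F2"]] by (simp add: ab_class_def)
  then obtain x where "x \<in> derived F2 (carrier F2)" "u = x \<otimes>\<^bsub>F2\<^esub> ?w"
    by (auto simp: r_coset_def)
  then have "u \<in> H" using D T[OF v] subgroup.m_closed[OF H] by blast
  then show ?case by (simp add: H_def del: lower_central.simps)
qed

theorem theorem7p7:
  fixes \<phi> :: "(2 \<times> bool) list \<Rightarrow> (2 \<times> bool) list"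
  assumes "\<phi> \<in> auto F2"
    and "det (ab_matrix \<phi>) = 1"
  shows "residually_nilpotent (semidirect_int F2 \<phi>) \<longleftrightarrow> trace (ab_matrix \<phi>) \<notin> {1, 3}"
proof
  let ?S = "semidirect_int F2 \<phi>"
  interpret F: group F2 by (rule group_free_group)
  interpret S: group ?S by (rule F.group_semidirect_int[OF assms(1)])
  assume "residually_nilpotent ?S"
  then have 1: "(\<Inter>n. lower_central ?S n) = {\<one>\<^bsub>?S\<^esub>}" by (simp add: S.residually_nilpotent_iff)
  show "trace (ab_matrix \<phi>) \<notin> {1, 3}"
  proof
    assume "trace (ab_matrix \<phi>) \<in> {1, 3}"
    then have "(0, free_gen 1) \<in> (\<Inter>n. lower_central ?S n)"
      using free_group_subset_lower_central[OF assms _ free_gen_closed] by blast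
    then show False
      unfolding 1 by (simp add: semidirect_int_def one_free_group free_gen_def)
  qed
next
  assume "trace (ab_matrix \<phi>) \<notin> {1, 3}"
  \<comment> \<open>Exactly the traces 1 and 3 give absolute value 1. For trace 2 the number is 0,
    which every prime divides.\<close>
  then have "nat \<bar>2 - trace (ab_matrix \<phi>)\<bar> \<noteq> 1" by auto
  then obtain p where p: "prime p" "p dvd nat \<bar>2 - trace (ab_matrix \<phi>)\<bar>"
    using prime_factor_nat by blast
  then have "int p dvd 2 - trace (ab_matrix \<phi>)" by (simp add: dvd_nat_abs_iff)
  then show "residually_nilpotent (semidirect_int F2 \<phi>)"
    by (rule residually_nilpotent_semidirect[OF assms p(1)])
qed

end
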